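(* Let $n\ge1$, $s\in(0,1)$. There exists $c\in(0,1)$, depending only on $n$ and $s$, such that for all disjoint measurable sets $A,B\subset\mathbb{R}^n$, with $D:=\mathbb{R}^n\setminus(A\cup B)$: <ul> <li>if $|B|\le c|A|$ and $|A|>0$, then $$L(A,D)\ge\begin{cases}c\,|A|^{(n-2s)/n} & \text{if } s\in(0,1/2),\\ c\,|A|^{(n-1)/n}\log(|A|/|B|) & \text{if } s=1/2,\\ c\,|A|^{(n-2s)/n}\big(|B|/|A|\big)^{1-2s} & \text{if } s\in(1/2,1);\end{cases}$$</li> <li>if $|B|>c|A|$, then $L(A,D)\ge c\,|A|^{(n-2s)/n}\big(|B|/|A|\big)^{-2s/n}$.</li> </ul>
   Context: For measurable $A,D\subset\mathbb{R}^n$, $L(A,D):=\int_A\int_D\frac{dx\,dy}{|x-y|^{n+2s}}$. $|\cdot|$ denotes Lebesgue measure.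
   Formalization: A and B are taken of finite measure (the claim fails for |A|=∞: B a ball, A its complement, D empty; for |B|=∞ the bound is 0). For |B|=0 and s≥1/2, where the bound is undefined, it is read as 0; the value +∞ follows by moving small pieces of A into B. *)

theory Defs
  imports "HOL-Analysis.Analysis"
begin

definition Lint :: "real \<Rightarrow> ('a::euclidean_space) set \<Rightarrow> 'a set \<Rightarrow> ennreal" where
  "Lint s A D =
     (\<integral>\<^sup>+ x\<in>A. (\<integral>\<^sup>+ y\<in>D. ennreal (1 / norm (x - y) powr (real DIM('a) + 2 * s)) \<partial>lebesgue) \<partial>lebesgue)"

end

theory Submission
  imports Defs
begin

text \<open>
  For a translation \<open>h\<close> let \<open>G(h) = |A - (A - h)|\<close>. This is subadditive, so \<open>G(m h) \<le> m G(h)\<close>, and hence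
  the volume of the pairs in \<open>A \<times> (- A)\<close> at distance less than \<open>r\<close> is at least \<open>m powr (- n - 1)\<close> times
  the same volume at scale \<open>m r\<close>. At the scale of a ball of volume comparable to \<open>|A|\<close> the latter is
  trivially of order \<open>|A|\<^sup>2\<close>. This gives a nonlocal isoperimetric inequality at every scale, of order
  \<open>r powr (n + 1) * |A| powr ((n - 1) / n)\<close>, and removing \<open>B\<close> costs only \<open>|B| r powr n\<close>. Integrating over
  scales (layer cake) between \<open>|A| powr (1 / n) * |B| / |A|\<close> and \<open>|A| powr (1 / n)\<close> yields the logarithm
  for \<open>s = 1/2\<close> and the power for \<open>s > 1/2\<close>; the remaining bounds only use pairs at distance comparable
  to the radius of a ball of volume \<open>|A| + |B|\<close>.
\<close>

section \<open>Affine changes of variables for Lebesgue integrals\<close>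

lemma nn_integral_lborel_affine:
  fixes t :: "'a::euclidean_space" and f :: "'a \<Rightarrow> ennreal"
  assumes [measurable]: "f \<in> borel_measurable borel" and "c \<noteq> 0"
  shows "(\<integral>\<^sup>+x. f x \<partial>lborel) = ennreal (\<bar>c\<bar> ^ DIM('a)) * (\<integral>\<^sup>+x. f (t + c *\<^sub>R x) \<partial>lborel)"
  by (subst lborel_affine[OF \<open>c \<noteq> 0\<close>, of t])
     (simp add: nn_integral_density nn_integral_distr nn_integral_cmult)

lemma nn_integral_lborel_shift:
  fixes t :: "'a::euclidean_space" and f :: "'a \<Rightarrow> ennreal"
  assumes "f \<in> borel_measurable borel"
  shows "(\<integral>\<^sup>+x. f (x + t) \<partial>lborel) = (\<integral>\<^sup>+x. f x \<partial>lborel)"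
  using nn_integral_lborel_affine[OF assms, of 1 t] by (simp add: add.commute)

lemma ball_in_sets_borel [measurable]: "ball c r \<in> sets borel"
  by simp

section \<open>Overlaps under translation and volumes of close pairs\<close>

text \<open>The cross-covariogram of X and Y, that is, the volume of X \<inter> (Y - h). For Y = -X
  it is the function G(h) of the overview. Values in \<open>ennreal\<close> allow Y to be a
  complement of infinite volume.\<close>

definition overlap :: "'a::euclidean_space set \<Rightarrow> 'a set \<Rightarrow> 'a \<Rightarrow> ennreal" where
  "overlap X Y h = (\<integral>\<^sup>+x. indicator X x * indicator Y (x + h) \<partial>lborel)"

text \<open>The volume of the pairs (x, y) in X \<times> Y with |x - y| < r, written with the
  difference vector h = y - x as outer variable so that h can be rescaled.\<close>

definition close_pairs :: "'a::euclidean_space set \<Rightarrow> 'a set \<Rightarrow> real \<Rightarrow> ennreal" where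
  "close_pairs X Y r = (\<integral>\<^sup>+h. indicator (ball 0 r) h * overlap X Y h \<partial>lborel)"

lemma measurable_overlap [measurable]:
  assumes [measurable]: "X \<in> sets borel" "Y \<in> sets borel"
  shows "overlap X Y \<in> borel_measurable borel"
  unfolding overlap_def by measurable

lemma overlap_Un_left:
  assumes [measurable]: "X \<in> sets borel" "X' \<in> sets borel" "Y \<in> sets borel" and "X \<inter> X' = {}"
  shows "overlap (X \<union> X') Y h = overlap X Y h + overlap X' Y h"
proof -
  have "indicator (X \<union> X') x * indicator Y (x + h)
    = (indicator X x * indicator Y (x + h) + indicator X' x * indicator Y (x + h) :: ennreal)" for x
    using \<open>X \<inter> X' = {}\<close> by (auto simp: indicator_def)
  then show ?thesis
    unfolding overlap_def by (simp add: nn_integral_add)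
qed

lemma overlap_Un_right:
  assumes [measurable]: "X \<in> sets borel" "Y \<in> sets borel" "Y' \<in> sets borel" and "Y \<inter> Y' = {}"
  shows "overlap X (Y \<union> Y') h = overlap X Y h + overlap X Y' h"
proof -
  have "indicator X x * indicator (Y \<union> Y') (x + h)
    = (indicator X x * indicator Y (x + h) + indicator X x * indicator Y' (x + h) :: ennreal)" for x
    using \<open>Y \<inter> Y' = {}\<close> by (auto simp: indicator_def)
  then show ?thesis
    unfolding overlap_def by (simp add: nn_integral_add)
qed

lemma overlap_swap:
  assumes [measurable]: "X \<in> sets borel" "Y \<in> sets borel"
  shows "overlap X Y h = overlap Y X (- h)"
  unfolding overlap_def
  by (subst nn_integral_lborel_shift[symmetric, where t = "-h"]) (simp_all add: mult.commute)

lemma overlap_UNIV: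
  assumes "X \<in> sets borel"
  shows "overlap X UNIV h = emeasure lborel X"
  using assms by (simp add: overlap_def)

lemma overlap_0:
  fixes X :: "'a::euclidean_space set"
  assumes "X \<inter> Y = {}"
  shows "overlap X Y 0 = 0"
proof -
  have "indicator X x * indicator Y x = (0::ennreal)" for x
    using assms by (auto simp: indicator_def)
  then have "overlap X Y 0 = (\<integral>\<^sup>+x. 0 \<partial>(lborel :: 'a measure))"
    unfolding overlap_def by (simp only: add_0_right)
  then show ?thesis by simp
qed

text \<open>A point of X that the displacement h + k carries out of X either leaves X already after
  h, or is still in X after h and leaves it during the step k.\<close>

lemma overlap_compl_add:
  assumes [measurable]: "X \<in> sets borel"
  shows "overlap X (- X) (h + k) \<le> overlap X (- X) h + overlap X (- X) k"
proof -
  have "overlap X (- X) (h + k)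
    \<le> (\<integral>\<^sup>+x. indicator X x * indicator (- X) (x + h)
          + indicator X (x + h) * indicator (- X) ((x + h) + k) \<partial>lborel)"
    unfolding overlap_def by (intro nn_integral_mono) (auto simp: indicator_def add.assoc)
  also have "\<dots> = overlap X (- X) h
      + (\<integral>\<^sup>+x. indicator X (x + h) * indicator (- X) ((x + h) + k) \<partial>lborel)"
    unfolding overlap_def by (simp add: nn_integral_add)
  also have "(\<integral>\<^sup>+x. indicator X (x + h) * indicator (- X) ((x + h) + k) \<partial>lborel) = overlap X (- X) k"
    unfolding overlap_def
    by (rule nn_integral_lborel_shift[where f = "\<lambda>x. indicator X x * indicator (- X) (x + k)"]) simp
  finally show ?thesis .
qed

lemma overlap_compl_scaleR_le:
  assumes "X \<in> sets borel"
  shows "overlap X (- X) (real m *\<^sub>R h) \<le> of_nat m * overlap X (- X) h"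
proof (induction m)
  case 0
  show ?case by (simp add: overlap_0)
next
  case (Suc m)
  have "overlap X (- X) (real (Suc m) *\<^sub>R h) \<le> overlap X (- X) h + overlap X (- X) (real m *\<^sub>R h)"
    using overlap_compl_add[OF assms, of h "real m *\<^sub>R h"] by (simp add: scaleR_left.add algebra_simps)
  also have "\<dots> \<le> overlap X (- X) h + of_nat m * overlap X (- X) h"
    using Suc by (intro add_left_mono)
  finally show ?case by (simp add: algebra_simps)
qed

lemma close_pairs_Un_left:
  assumes [measurable]: "X \<in> sets borel" "X' \<in> sets borel" "Y \<in> sets borel" and "X \<inter> X' = {}"
  shows "close_pairs (X \<union> X') Y r = close_pairs X Y r + close_pairs X' Y r"
  unfolding close_pairs_def
  by (simp add: overlap_Un_left[OF assms] distrib_left nn_integral_add)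

lemma close_pairs_Un_right:
  assumes [measurable]: "X \<in> sets borel" "Y \<in> sets borel" "Y' \<in> sets borel" and "Y \<inter> Y' = {}"
  shows "close_pairs X (Y \<union> Y') r = close_pairs X Y r + close_pairs X Y' r"
  unfolding close_pairs_def
  by (simp add: overlap_Un_right[OF assms] distrib_left nn_integral_add)

lemma close_pairs_commute:
  assumes [measurable]: "X \<in> sets borel" "Y \<in> sets borel"
  shows "close_pairs X Y r = close_pairs Y X r"
proof -
  have "close_pairs X Y r = (\<integral>\<^sup>+h. indicator (ball 0 r) (- h) * overlap X Y (- h) \<partial>lborel)"
    unfolding close_pairs_def by (subst nn_integral_lborel_affine[where c = "-1" and t = 0]) simp_all
  also have "\<dots> = close_pairs Y X r"
    unfolding close_pairs_def overlap_swap[OF assms(2,1)] by (simp add: indicator_def)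
  finally show ?thesis .
qed

lemma close_pairs_UNIV:
  fixes X :: "'a::euclidean_space set"
  assumes [measurable]: "X \<in> sets borel" and "0 \<le> r"
  shows "close_pairs X UNIV r = emeasure lborel X * ennreal (unit_ball_vol DIM('a) * r ^ DIM('a))"
  unfolding close_pairs_def
  by (simp add: overlap_UNIV nn_integral_multc emeasure_ball \<open>0 \<le> r\<close>) (simp add: mult.commute)

text \<open>Dropping the distance restriction leaves an integral that factors by Tonelli. This crude
  bound discards the pairs that stay inside a set of known volume.\<close>

lemma close_pairs_le_mult:
  assumes [measurable]: "X \<in> sets borel" "Y \<in> sets borel"
  shows "close_pairs X Y r \<le> emeasure lborel X * emeasure lborel Y"
proof -
  have "close_pairs X Y r \<le> (\<integral>\<^sup>+h. overlap X Y h \<partial>lborel)"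
    unfolding close_pairs_def by (intro nn_integral_mono) (auto simp: indicator_def)
  also have "\<dots> = (\<integral>\<^sup>+x. \<integral>\<^sup>+h. indicator X x * indicator Y (h + x) \<partial>lborel \<partial>lborel)"
    unfolding overlap_def
    by (subst lborel_pair.Fubini') (simp_all add: add.commute)
  also have "\<dots> = (\<integral>\<^sup>+x. indicator X x * emeasure lborel Y \<partial>lborel)"
  proof (intro nn_integral_cong)
    fix x
    show "(\<integral>\<^sup>+h. indicator X x * indicator Y (h + x) \<partial>lborel) = indicator X x * emeasure lborel Y"
      using nn_integral_lborel_shift[of "\<lambda>h. indicator X x * indicator Y h" x]
      by (simp add: nn_integral_cmult)
  qed
  also have "\<dots> = emeasure lborel X * emeasure lborel Y"
    by (simp add: nn_integral_multc)
  finally show ?thesis .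
qed

section \<open>Scaling inequality and lower bounds for close pairs\<close>

text \<open>The substitution of m h for h contributes the Jacobian m^n, and subadditivity of the
  overlap contributes one further factor m.\<close>

lemma close_pairs_compl_scale:
  fixes X :: "'a::euclidean_space set"
  assumes [measurable]: "X \<in> sets borel" and "0 < m"
  shows "close_pairs X (- X) (real m * r) \<le> ennreal (real m ^ (DIM('a) + 1)) * close_pairs X (- X) r"
proof -
  have ball: "real m *\<^sub>R h \<in> ball 0 (real m * r) \<longleftrightarrow> h \<in> ball 0 r" for h :: 'a
    using \<open>0 < m\<close> by simp
  have "close_pairs X (- X) (real m * r) = ennreal (real m ^ DIM('a)) *
      (\<integral>\<^sup>+h. indicator (ball 0 (real m * r)) (real m *\<^sub>R h) * overlap X (- X) (real m *\<^sub>R h) \<partial>lborel)"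
    unfolding close_pairs_def
    by (subst nn_integral_lborel_affine[where c = "real m" and t = 0]) (use \<open>0 < m\<close> in simp_all)
  also have "\<dots> \<le> ennreal (real m ^ DIM('a)) *
      (\<integral>\<^sup>+h. of_nat m * (indicator (ball 0 r) h * overlap X (- X) h) \<partial>lborel)"
    using ball overlap_compl_scaleR_le[OF assms(1), of m]
    by (intro mult_left_mono nn_integral_mono) (auto simp: indicator_def)
  also have "\<dots> = ennreal (real m ^ DIM('a)) * of_nat m * close_pairs X (- X) r"
    unfolding close_pairs_def by (simp add: nn_integral_cmult mult.assoc)
  also have "ennreal (real m ^ DIM('a)) * of_nat m = ennreal (real m ^ (DIM('a) + 1))"
    by (simp add: ennreal_mult'' ennreal_of_nat_eq_real_of_nat mult.commute)
  finally show ?thesis .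
qed

text \<open>At the coarse scale m r all pairs starting in X have volume x times that of the ball,
  and at most x^2 of it stays in X; the remainder is carried down to scale r. The integer m stays
  free, since the best choice depends on the volume of X.\<close>

lemma close_pairs_compl_ge:
  fixes X :: "'a::euclidean_space set"
  assumes X [measurable]: "X \<in> sets borel" and x: "emeasure lborel X = ennreal x" "0 \<le> x"
    and "0 \<le> r" "0 < m"
  shows "ennreal ((x * (unit_ball_vol DIM('a) * (real m * r) ^ DIM('a)) - x\<^sup>2) / real m ^ (DIM('a) + 1))
    \<le> close_pairs X (- X) r"
\<comment> \<open>An infinite value satisfies the bound trivially; for a finite one the
  rearrangement can be carried out in the reals.\<close>
proof (cases "close_pairs X (- X) r")
  case (real v)
  let ?w = "unit_ball_vol DIM('a) * (real m * r) ^ DIM('a)"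
  have "ennreal (x * ?w) = close_pairs X UNIV (real m * r)"
    using x \<open>0 \<le> r\<close> by (simp add: close_pairs_UNIV ennreal_mult')
  also have "\<dots> = close_pairs X X (real m * r) + close_pairs X (- X) (real m * r)"
    using close_pairs_Un_right[of X X "- X"] by (simp add: Compl_partition)
  also have "\<dots> \<le> emeasure lborel X * emeasure lborel X + ennreal (real m ^ (DIM('a) + 1)) * ennreal v"
    using close_pairs_compl_scale[OF X \<open>0 < m\<close>, of r] real
    by (intro add_mono close_pairs_le_mult) simp_all
  also have "\<dots> = ennreal (x\<^sup>2 + real m ^ (DIM('a) + 1) * v)"
    using x real by (simp add: ennreal_mult' power2_eq_square ennreal_plus)
  finally have "x * ?w \<le> x\<^sup>2 + real m ^ (DIM('a) + 1) * v"
    using real by (subst (asm) ennreal_le_iff) auto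
  then have "(x * ?w - x\<^sup>2) / real m ^ (DIM('a) + 1) \<le> v"
    using \<open>0 < m\<close> by (subst pos_divide_le_eq) (auto simp: algebra_simps)
  then show ?thesis
    using real by (simp add: ennreal_leI)
qed simp

text \<open>At most |A| |E| of the pairs starting in A can end in E, so a ball larger than E must
  reach the complement of E from a typical point of A.\<close>

lemma close_pairs_far_ge:
  fixes A :: "'a::euclidean_space set"
  assumes [measurable]: "A \<in> sets borel" "E \<in> sets borel"
    and A: "emeasure lborel A = ennreal a" "0 \<le> a" and E: "emeasure lborel E = ennreal e" "0 \<le> e"
    and "0 \<le> r"
  shows "ennreal (a * (unit_ball_vol DIM('a) * r ^ DIM('a) - e)) \<le> close_pairs A (- E) r"
proof (cases "close_pairs A (- E) r")
  case (real v)
  let ?w = "unit_ball_vol DIM('a) * r ^ DIM('a)"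
  have "ennreal (a * ?w) = close_pairs A UNIV r"
    using A \<open>0 \<le> r\<close> by (simp add: close_pairs_UNIV ennreal_mult')
  also have "\<dots> = close_pairs A E r + close_pairs A (- E) r"
    using close_pairs_Un_right[of A E "- E"] by (simp add: Compl_partition)
  also have "\<dots> \<le> emeasure lborel A * emeasure lborel E + ennreal v"
    using real by (intro add_mono close_pairs_le_mult) simp_all
  also have "\<dots> = ennreal (a * e + v)"
    using A E real by (simp add: ennreal_mult' ennreal_plus)
  finally have "a * ?w \<le> a * e + v"
    using real A E by (subst (asm) ennreal_le_iff) auto
  then show ?thesis
    using real by (simp add: ennreal_leI algebra_simps)
qed simp

text \<open>Comparing the boundary layers of \<open>A\<close> and of \<open>A \<union> B\<close> loses only half of the pairs meeting
  \<open>B\<close>; the crude bound through \<open>A\<close> alone would not give the sharp constant needed on the line.\<close>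

lemma close_pairs_gap:
  fixes A :: "'a::euclidean_space set"
  assumes [measurable]: "A \<in> sets borel" "B \<in> sets borel" and "A \<inter> B = {}" and "0 \<le> r"
  shows "close_pairs A (- A) r + close_pairs (A \<union> B) (- (A \<union> B)) r
    \<le> 2 * close_pairs A (- (A \<union> B)) r
       + emeasure lborel B * ennreal (unit_ball_vol DIM('a) * r ^ DIM('a))"
proof -
  define D where "D = - (A \<union> B)"
  have [measurable]: "D \<in> sets borel" unfolding D_def by simp
  have "- A = B \<union> D" "B \<inter> D = {}" "A \<inter> D = {}"
    using \<open>A \<inter> B = {}\<close> by (auto simp: D_def)
  \<comment> \<open>With D the complement of A \<union> B, the two boundary layers together count
    the A-D pairs twice. What is left, the B-A and B-D pairs, are disjoint families with one point
    in B, hence jointly bounded by all close pairs starting in B.\<close>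
  then have 1: "close_pairs A (- A) r = close_pairs B A r + close_pairs A D r"
    by (simp add: close_pairs_Un_right close_pairs_commute[of A B])
  have 2: "close_pairs (A \<union> B) D r = close_pairs A D r + close_pairs B D r"
    using \<open>A \<inter> B = {}\<close> by (simp add: close_pairs_Un_left)
  have "UNIV = B \<union> (A \<union> D)" by (auto simp: D_def)
  then have "close_pairs B UNIV r = close_pairs B (B \<union> (A \<union> D)) r" by simp
  also have "\<dots> = close_pairs B B r + (close_pairs B A r + close_pairs B D r)"
    using \<open>A \<inter> B = {}\<close> \<open>B \<inter> D = {}\<close> \<open>A \<inter> D = {}\<close>
    by (subst close_pairs_Un_right; simp add: close_pairs_Un_right) blast
  finally have 3: "close_pairs B A r + close_pairs B D r \<le> close_pairs B UNIV r"
    by simp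
  have "close_pairs A (- A) r + close_pairs (A \<union> B) D r
      = 2 * close_pairs A D r + (close_pairs B A r + close_pairs B D r)"
    unfolding 1 2 by (simp add: mult_2 ac_simps)
  also have "\<dots> \<le> 2 * close_pairs A D r + close_pairs B UNIV r"
    by (intro add_left_mono 3)
  finally show ?thesis
    using \<open>0 \<le> r\<close> by (simp add: D_def close_pairs_UNIV)
qed

lemma close_pairs_gap_ge:
  fixes A :: "'a::euclidean_space set"
  assumes "A \<in> sets borel" "B \<in> sets borel" "A \<inter> B = {}" "0 \<le> r"
    and B: "emeasure lborel B = ennreal b" "0 \<le> b"
    and u: "ennreal u \<le> close_pairs A (- A) r"
    and v: "ennreal v \<le> close_pairs (A \<union> B) (- (A \<union> B)) r" and "0 \<le> u" "0 \<le> v"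
  shows "ennreal ((u + v - b * (unit_ball_vol DIM('a) * r ^ DIM('a))) / 2)
    \<le> close_pairs A (- (A \<union> B)) r"
proof (cases "close_pairs A (- (A \<union> B)) r")
  case (real d)
  let ?w = "unit_ball_vol DIM('a) * r ^ DIM('a)"
  have "ennreal (u + v) \<le> close_pairs A (- A) r + close_pairs (A \<union> B) (- (A \<union> B)) r"
    using u v \<open>0 \<le> u\<close> \<open>0 \<le> v\<close> by (simp add: add_mono)
  also have "\<dots> \<le> 2 * ennreal d + ennreal b * ennreal ?w"
    using close_pairs_gap[OF assms(1-4)] real B by simp
  also have "\<dots> = ennreal (2 * d + b * ?w)"
    using real B \<open>0 \<le> r\<close> by (simp add: ennreal_mult' ennreal_plus)
  finally have "u + v \<le> 2 * d + b * ?w"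
    using real B \<open>0 \<le> r\<close> by (subst (asm) ennreal_le_iff) auto
  then show ?thesis
    using real by (simp add: ennreal_leI)
qed simp

section \<open>The kernel energy: single-scale and layer-cake bounds\<close>

text \<open>The double integral over X \<times> Y, organised by difference vectors to make it
  comparable with \<open>close_pairs\<close>. The exponent p stands for n + 2s.\<close>

definition kernel_energy :: "real \<Rightarrow> 'a::euclidean_space set \<Rightarrow> 'a set \<Rightarrow> ennreal" where
  "kernel_energy p X Y = (\<integral>\<^sup>+h. ennreal (1 / norm h powr p) * overlap X Y h \<partial>lborel)"

lemma kernel_energy_eq_double_integral:
  assumes [measurable]: "X \<in> sets borel" "Y \<in> sets borel"
  shows "kernel_energy p X Y = (\<integral>\<^sup>+x\<in>X. (\<integral>\<^sup>+y\<in>Y. ennreal (1 / norm (x - y) powr p) \<partial>lborel) \<partial>lborel)"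
proof -
  have "kernel_energy p X Y
      = (\<integral>\<^sup>+h. \<integral>\<^sup>+x. ennreal (1 / norm h powr p) * (indicator X x * indicator Y (x + h)) \<partial>lborel \<partial>lborel)"
    unfolding kernel_energy_def overlap_def by (simp add: nn_integral_cmult)
  also have "\<dots> = (\<integral>\<^sup>+x. \<integral>\<^sup>+h. ennreal (1 / norm h powr p) * (indicator X x * indicator Y (x + h)) \<partial>lborel \<partial>lborel)"
    by (subst lborel_pair.Fubini') simp_all
  also have "\<dots> = (\<integral>\<^sup>+x\<in>X. (\<integral>\<^sup>+y\<in>Y. ennreal (1 / norm (x - y) powr p) \<partial>lborel) \<partial>lborel)"
  proof (intro nn_integral_cong)
    fix x
    have "(\<integral>\<^sup>+h. ennreal (1 / norm h powr p) * (indicator X x * indicator Y (x + h)) \<partial>lborel)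
      = (\<integral>\<^sup>+h. (ennreal (1 / norm (x - (h + x)) powr p) * indicator Y (h + x)) * indicator X x \<partial>lborel)"
      by (intro nn_integral_cong) (simp add: ac_simps)
    also have "\<dots> = (\<integral>\<^sup>+y. ennreal (1 / norm (x - y) powr p) * indicator Y y * indicator X x \<partial>lborel)"
      by (rule nn_integral_lborel_shift
            [where f = "\<lambda>y. ennreal (1 / norm (x - y) powr p) * indicator Y y * indicator X x"]) simp
    also have "\<dots> = (\<integral>\<^sup>+y\<in>Y. ennreal (1 / norm (x - y) powr p) \<partial>lborel) * indicator X x"
      by (simp add: nn_integral_multc)
    finally show "(\<integral>\<^sup>+h. ennreal (1 / norm h powr p) * (indicator X x * indicator Y (x + h)) \<partial>lborel)
      = (\<integral>\<^sup>+y\<in>Y. ennreal (1 / norm (x - y) powr p) \<partial>lborel) * indicator X x" .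
  qed
  finally show ?thesis .
qed

text \<open>Inside the ball the kernel is at least \<open>r powr - p\<close>, so one well-chosen
  scale already bounds the energy; this suffices whenever a single scale dominates.\<close>

lemma close_pairs_le_kernel_energy:
  fixes X :: "'a::euclidean_space set"
  assumes [measurable]: "X \<in> sets borel" "Y \<in> sets borel" and "X \<inter> Y = {}" "0 < r" "0 < p"
  shows "ennreal (r powr - p) * close_pairs X Y r \<le> kernel_energy p X Y"
proof -
  have "ennreal (r powr - p) * close_pairs X Y r
      = (\<integral>\<^sup>+h. ennreal (r powr - p) * (indicator (ball 0 r) h * overlap X Y h) \<partial>lborel)"
    unfolding close_pairs_def by (simp add: nn_integral_cmult)
  also have "\<dots> \<le> kernel_energy p X Y"
    unfolding kernel_energy_def
  proof (intro nn_integral_mono)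
    fix h :: 'a
    show "ennreal (r powr - p) * (indicator (ball 0 r) h * overlap X Y h)
      \<le> ennreal (1 / norm h powr p) * overlap X Y h"
    \<comment> \<open>At h = 0 the kernel takes the default value \<open>1 / 0 = 0\<close>; the
      comparison survives because disjoint sets have no overlap there.\<close>
    proof (cases "h = 0 \<or> h \<notin> ball 0 r")
      case True
      then show ?thesis using overlap_0[OF \<open>X \<inter> Y = {}\<close>] by auto
    next
      case False
      then have "norm h powr p \<le> r powr p"
        using \<open>0 < p\<close> by (intro powr_mono2) auto
      then have "r powr - p \<le> 1 / norm h powr p"
        using False by (simp add: powr_minus_divide frac_le)
      then show ?thesis using False by (auto intro!: mult_right_mono ennreal_leI)
    qed
  qed
  finally show ?thesis .
qed

text \<open>Writes the kernel as a superposition of indicators of the balls r > |h| with weight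
  \<open>p * r powr (- p - 1)\<close>, the source of the layer cake.\<close>

lemma nn_integral_powr_atLeast:
  assumes "0 < t" "0 < p"
  shows "(\<integral>\<^sup>+r. ennreal (p * r powr (- p - 1)) * indicator {t..} r \<partial>lborel) = ennreal (1 / t powr p)"
proof -
  have "(\<integral>\<^sup>+r. ennreal (p * r powr (- p - 1)) * indicator {t..} r \<partial>lborel) = ennreal (0 - (- (t powr - p)))"
  proof (rule nn_integral_FTC_atLeast)
    show "((\<lambda>r. - (r powr - p)) has_real_derivative p * r powr (- p - 1)) (at r)" if "t \<le> r" for r
      using that \<open>0 < t\<close> by (auto intro!: derivative_eq_intros)
    have "((\<lambda>r. - (r powr - p)) \<longlongrightarrow> - 0) at_top"
      using \<open>0 < p\<close> by (intro tendsto_minus tendsto_neg_powr filterlim_ident) auto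
    then show "((\<lambda>r. - (r powr - p)) \<longlongrightarrow> 0) at_top" by simp
  qed (use assms in auto)
  then show ?thesis by (simp add: powr_minus_divide)
qed

text \<open>The right side integrates only the positive part of f. This permits layer-cake lower
  bounds that become negative on part of the scale range.\<close>

lemma ennreal_integral_le_nn_integral:
  assumes "has_bochner_integral M f I"
  shows "ennreal I \<le> (\<integral>\<^sup>+x. ennreal (f x) \<partial>M)"
proof -
  have f: "integrable M f" "I = integral\<^sup>L M f"
    using assms by (auto simp: has_bochner_integral_iff)
  have "I \<le> (\<integral>x. max 0 (f x) \<partial>M)"
    unfolding f(2) by (intro integral_mono f integrable_max) auto
  then have "ennreal I \<le> ennreal (\<integral>x. max 0 (f x) \<partial>M)" by (rule ennreal_leI)
  also have "\<dots> = (\<integral>\<^sup>+x. ennreal (max 0 (f x)) \<partial>M)"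
    by (intro nn_integral_eq_integral[symmetric] integrable_max f) auto
  also have "\<dots> = (\<integral>\<^sup>+x. ennreal (f x) \<partial>M)"
    by (intro nn_integral_cong) (auto simp: max_def ennreal_neg)
  finally show ?thesis .
qed

text \<open>Keeping only the levels r in [r1, r2] of the superposition decreases the kernel, and
  Tonelli turns what remains into a weighted integral of \<open>close_pairs\<close>. The
  antiderivative F lets the caller supply the integral in closed form.\<close>

lemma kernel_energy_layer_cake:
  fixes X :: "'a::euclidean_space set"
  assumes [measurable]: "X \<in> sets borel" "Y \<in> sets borel" and "X \<inter> Y = {}" "0 < p"
    and "0 < r1" "r1 \<le> r2"
    and F: "\<And>r. r1 \<le> r \<Longrightarrow> r \<le> r2 \<Longrightarrow> (F has_real_derivative p * r powr (- p - 1) * f r) (at r)"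
    and f: "\<And>r. r1 \<le> r \<Longrightarrow> r \<le> r2 \<Longrightarrow> ennreal (f r) \<le> close_pairs X Y r"
    and cont: "continuous_on {r1..r2} f"
  shows "ennreal (F r2 - F r1) \<le> kernel_energy p X Y"
proof -
  let ?w = "\<lambda>r. p * r powr (- p - 1)"
  \<comment> \<open>The kernel with its levels restricted to [r1, r2]; it lies below the full kernel
    for h \<noteq> 0.\<close>
  define k :: "'a \<Rightarrow> ennreal" where
    "k h = (\<integral>\<^sup>+r. ennreal (?w r) * indicator {r1..r2} r * indicator {norm h<..} r \<partial>lborel)" for h
  have "has_bochner_integral lborel (\<lambda>r. indicator {r1..r2} r *\<^sub>R (?w r * f r)) (F r2 - F r1)"
  proof (rule has_bochner_integral_FTC_Icc[OF \<open>r1 \<le> r2\<close>])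
    show "(F has_vector_derivative ?w r * f r) (at r within {r1..r2})" if "r1 \<le> r" "r \<le> r2" for r
      using F[OF that] DERIV_subset unfolding has_real_derivative_iff_has_vector_derivative[symmetric]
      by blast
    show "continuous_on {r1..r2} (\<lambda>r. ?w r * f r)"
      using \<open>0 < r1\<close> by (intro continuous_intros cont) auto
  qed
  then have "ennreal (F r2 - F r1) \<le> (\<integral>\<^sup>+r. ennreal (indicator {r1..r2} r *\<^sub>R (?w r * f r)) \<partial>lborel)"
    by (rule ennreal_integral_le_nn_integral)
  also have "\<dots> \<le> (\<integral>\<^sup>+r. ennreal (?w r) * indicator {r1..r2} r * close_pairs X Y r \<partial>lborel)"
  proof (intro nn_integral_mono)
    fix r
    show "ennreal (indicator {r1..r2} r *\<^sub>R (?w r * f r))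
      \<le> ennreal (?w r) * indicator {r1..r2} r * close_pairs X Y r"
      using f[of r] \<open>0 < p\<close> by (auto simp: indicator_def ennreal_mult' intro!: mult_left_mono)
  qed
  also have "\<dots> = (\<integral>\<^sup>+r. \<integral>\<^sup>+h. ennreal (?w r) * indicator {r1..r2} r * (indicator {norm h<..} r * overlap X Y h) \<partial>lborel \<partial>lborel)"
  proof (intro nn_integral_cong)
    fix r
    have ball: "indicator (ball 0 r) h = (indicator {norm h<..} r :: ennreal)" for h :: 'a
      by (auto simp: indicator_def)
    show "ennreal (?w r) * indicator {r1..r2} r * close_pairs X Y r
      = (\<integral>\<^sup>+h. ennreal (?w r) * indicator {r1..r2} r * (indicator {norm h<..} r * overlap X Y h) \<partial>lborel)"
      unfolding close_pairs_def ball[symmetric] by (simp add: nn_integral_cmult)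
  qed
  also have "\<dots> = (\<integral>\<^sup>+h. \<integral>\<^sup>+r. ennreal (?w r) * indicator {r1..r2} r * (indicator {norm h<..} r * overlap X Y h) \<partial>lborel \<partial>lborel)"
    by (subst lborel_pair.Fubini') (simp_all add: greaterThan_def)
  also have "\<dots> = (\<integral>\<^sup>+h. k h * overlap X Y h \<partial>lborel)"
    unfolding k_def by (simp add: nn_integral_multc[symmetric] mult.assoc)
  also have "\<dots> \<le> kernel_energy p X Y"
    unfolding kernel_energy_def
  proof (intro nn_integral_mono)
    fix h :: 'a
    show "k h * overlap X Y h \<le> ennreal (1 / norm h powr p) * overlap X Y h"
    proof (cases "h = 0")
      case True
      then show ?thesis using overlap_0[OF \<open>X \<inter> Y = {}\<close>] by simp
    next
      case False
      have "k h \<le> (\<integral>\<^sup>+r. ennreal (?w r) * indicator {norm h..} r \<partial>lborel)"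
        unfolding k_def by (intro nn_integral_mono) (auto simp: indicator_def)
      also have "\<dots> = ennreal (1 / norm h powr p)"
        using False \<open>0 < p\<close> by (intro nn_integral_powr_atLeast) auto
      finally show ?thesis by (rule mult_right_mono) simp
    qed
  qed
  finally show ?thesis .
qed

section \<open>Passage from Lebesgue to Borel sets\<close>

lemma Lint_ge_kernel_energy:
  fixes A B :: "'a::euclidean_space set"
  assumes A: "A \<in> sets lebesgue" "emeasure lebesgue A < \<infinity>"
    and B: "B \<in> sets lebesgue" "emeasure lebesgue B < \<infinity>" and disj: "A \<inter> B = {}"
  obtains A' B' :: "'a set" where "A' \<in> sets borel" "B' \<in> sets borel" "A' \<inter> B' = {}"
    "emeasure lborel A' = ennreal (measure lebesgue A)"
    "emeasure lborel B' = ennreal (measure lebesgue B)"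
    "kernel_energy (real DIM('a) + 2 * s) A' (- (A' \<union> B')) \<le> Lint s A (UNIV - (A \<union> B))"
proof -
  define D where "D = UNIV - (A \<union> B)"
  have D: "D \<in> sets lebesgue" using A(1) B(1) by (auto simp: D_def)
  define A' where "A' = main_part lborel A"
  define D' where "D' = main_part lborel D"
  \<comment> \<open>Taking a complement instead of the main part of B makes the complement of A'
    \<union> B' equal to D' exactly; the null parts removed from A and D are absorbed by B'.\<close>
  define B' where "B' = - (A' \<union> D')"
  have borel [measurable]: "A' \<in> sets borel" "D' \<in> sets borel"
    using main_part_sets[OF A(1)] main_part_sets[OF D] by (auto simp: A'_def D'_def)
  have A': "A' \<union> null_part lborel A = A" and D': "D' \<union> null_part lborel D = D"
    using main_part_null_part_Un[OF A(1)] main_part_null_part_Un[OF D] by (auto simp: A'_def D'_def)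
  have BB: "B \<subseteq> B'" "B' \<subseteq> B \<union> (null_part lborel A \<union> null_part lborel D)"
    using A' D' disj by (auto simp: B'_def D_def)
  have np: "null_part lborel S \<in> null_sets lebesgue" if S: "S \<in> sets lebesgue" for S :: "'a set"
    using null_part[OF S] by (blast intro: null_sets_completionI null_sets_completion_subset)
  have null: "emeasure lebesgue (null_part lborel A) = 0" "null_part lborel A \<in> sets lebesgue"
     "emeasure lebesgue (null_part lborel D) = 0" "null_part lborel D \<in> sets lebesgue"
    using np[OF A(1)] np[OF D] by (auto dest: null_setsD1 null_setsD2)
  have "emeasure lborel B' = emeasure lebesgue B'"
    by (simp add: B'_def)
  also have "\<dots> = emeasure lebesgue B"
  proof (rule antisym)
    have "emeasure lebesgue B'
        \<le> emeasure lebesgue (B \<union> (null_part lborel A \<union> null_part lborel D))"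
      using BB null B by (intro emeasure_mono) auto
    also have "\<dots> \<le> emeasure lebesgue B +
        (emeasure lebesgue (null_part lborel A) + emeasure lebesgue (null_part lborel D))"
      using null B by (intro order.trans[OF emeasure_subadditive] add_left_mono emeasure_subadditive) auto
    finally show "emeasure lebesgue B' \<le> emeasure lebesgue B" using null by simp
    show "emeasure lebesgue B \<le> emeasure lebesgue B'"
      using BB by (intro emeasure_mono) (auto simp: B'_def)
  qed
  finally have eB: "emeasure lborel B' = ennreal (measure lebesgue B)"
    using B(2) by (simp add: emeasure_eq_ennreal_measure)
  have eA: "emeasure lborel A' = ennreal (measure lebesgue A)"
    using A emeasure_completion[OF A(1)] by (simp add: A'_def emeasure_eq_ennreal_measure)
  have "- (A' \<union> B') = D'"
    using A' D' by (auto simp: B'_def D_def)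
  then have "kernel_energy (real DIM('a) + 2 * s) A' (- (A' \<union> B'))
    = (\<integral>\<^sup>+x\<in>A'. (\<integral>\<^sup>+y\<in>D'. ennreal (1 / norm (x - y) powr (real DIM('a) + 2 * s)) \<partial>lborel) \<partial>lborel)"
    by (simp add: kernel_energy_eq_double_integral)
  also have "\<dots> \<le> (\<integral>\<^sup>+x\<in>A. (\<integral>\<^sup>+y\<in>D. ennreal (1 / norm (x - y) powr (real DIM('a) + 2 * s)) \<partial>lborel) \<partial>lborel)"
    using A' D' by (intro nn_integral_mono mult_mono) (auto simp: indicator_def)
  also have "\<dots> = Lint s A (UNIV - (A \<union> B))"
    by (simp add: Lint_def D_def nn_integral_completion)
  finally show ?thesis
    using that[of A' B'] eA eB by (auto simp: B'_def)
qed

section \<open>Energy bounds with explicit constants in every dimension\<close>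

lemma kernel_energy_ge_far:
  fixes A :: "'a::euclidean_space set"
  assumes [measurable]: "A \<in> sets borel" "B \<in> sets borel" and "A \<inter> B = {}"
    and A: "emeasure lborel A = ennreal a" "0 < a" and B: "emeasure lborel B = ennreal b" "0 \<le> b"
    and "0 < s"
  shows "ennreal ((2 / unit_ball_vol DIM('a)) powr (- (real DIM('a) + 2 * s) / real DIM('a))
      * (a * (a + b) powr (- 2 * s / real DIM('a))))
    \<le> kernel_energy (real DIM('a) + 2 * s) A (- (A \<union> B))"
proof -
  define \<omega> where "\<omega> = unit_ball_vol (real DIM('a))"
  define n where "n = real DIM('a)"
  \<comment> \<open>The ball of radius r has volume 2 (a + b), so A \<union> B fills at most half of
    it around any point and pairs of volume at least a (a + b) reach the complement.\<close>
  define r where "r = (2 * (a + b) / \<omega>) powr (1 / n)"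
  have pos: "0 < \<omega>" "0 < n" by (simp_all add: \<omega>_def n_def)
  then have "0 < r" using A B by (simp add: r_def)
  note pos = pos this
  have rn: "\<omega> * r ^ DIM('a) = 2 * (a + b)"
    using pos A B by (simp add: r_def n_def powr_powr flip: powr_realpow)
  have E: "emeasure lborel (A \<union> B) = ennreal (a + b)"
    using A B \<open>A \<inter> B = {}\<close> by (simp add: plus_emeasure[symmetric] ennreal_plus)
  have "ennreal (a * (a + b)) \<le> close_pairs A (- (A \<union> B)) r"
    using close_pairs_far_ge[of A "A \<union> B" a "a + b" r] E A B pos rn by (simp add: \<omega>_def)
  then have "ennreal (r powr - (n + 2 * s)) * ennreal (a * (a + b))
      \<le> ennreal (r powr - (n + 2 * s)) * close_pairs A (- (A \<union> B)) r"
    by (intro mult_left_mono) auto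
  also have "\<dots> \<le> kernel_energy (n + 2 * s) A (- (A \<union> B))"
    using pos \<open>0 < s\<close> by (intro close_pairs_le_kernel_energy) auto
  also have "ennreal (r powr - (n + 2 * s)) * ennreal (a * (a + b))
      = ennreal (r powr - (n + 2 * s) * (a * (a + b)))"
    by (simp add: ennreal_mult')
  also have "r powr - (n + 2 * s) = (2 / \<omega> * (a + b)) powr (- (n + 2 * s) / n)"
    by (simp add: r_def powr_powr)
  also have "\<dots> = (2 / \<omega>) powr (- (n + 2 * s) / n) * (a + b) powr (- (n + 2 * s) / n)"
    using pos A B by (intro powr_mult)
  also have "- (n + 2 * s) / n = - 2 * s / n - 1"
    using pos by (simp add: field_simps)
  also have "(a + b) powr (- 2 * s / n - 1) = (a + b) powr (- 2 * s / n) / (a + b)"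
    using A B by (subst powr_diff) simp
  also have "(2 / \<omega>) powr (- 2 * s / n - 1) * ((a + b) powr (- 2 * s / n) / (a + b)) * (a * (a + b))
      = (2 / \<omega>) powr (- 2 * s / n - 1) * (a * (a + b) powr (- 2 * s / n))"
    using A B by simp
  also have "- 2 * s / n - 1 = - (n + 2 * s) / n"
    using pos by (simp add: field_simps)
  finally show ?thesis
    by (simp only: \<omega>_def n_def)
qed

text \<open>At scales between \<open>R |B|/|A|\<close> and \<open>R\<close>, where \<open>R\<close> is comparable to the radius of a ball of volume
  \<open>|A|\<close>, the set \<open>B\<close> is too small to screen \<open>A\<close>: a fixed fraction of the boundary layer survives.\<close>

lemma close_pairs_intermediate_scale:
  fixes A :: "'a::euclidean_space set"
  assumes [measurable]: "A \<in> sets borel" "B \<in> sets borel" and "A \<inter> B = {}"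
    and A: "emeasure lborel A = ennreal a" "0 < a" and B: "emeasure lborel B = ennreal b" "0 \<le> b"
    and "b \<le> a" "0 < R" and R: "unit_ball_vol DIM('a) * R ^ DIM('a) = 4 * a"
    and r: "0 < r" "r \<le> R" "2 ^ (DIM('a) + 1) * R * (b / a) \<le> r"
  shows "ennreal (a\<^sup>2 * (r / (2 * R)) ^ (DIM('a) + 1)) \<le> close_pairs A (- (A \<union> B)) r"
proof -
  define \<omega> where "\<omega> = unit_ball_vol (real DIM('a))"
  let ?n = "DIM('a)"
  \<comment> \<open>Rounding up gives m r \<ge> R, and since R / r \<ge> 1 it at most doubles the
    quotient.\<close>
  define m where "m = nat \<lceil>R / r\<rceil>"
  have pos: "0 < \<omega>" by (simp add: \<omega>_def)
  have "1 \<le> R / r" using r by simp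
  then have m: "0 < m" "R / r \<le> real m" "real m \<le> 2 * (R / r)"
    unfolding m_def by linarith+
  define t where "t = \<omega> * (real m * r) ^ ?n"
  have "R \<le> real m * r" using m r by (simp add: field_simps)
  then have "R ^ ?n \<le> (real m * r) ^ ?n"
    using \<open>0 < R\<close> by (intro power_mono) auto
  then have t: "4 * a \<le> t"
    using R pos unfolding t_def \<omega>_def[symmetric] by (metis mult_left_mono less_imp_le)
  define u where "u = (a * t - a\<^sup>2) / real m ^ (?n + 1)"
  define v where "v = ((a + b) * t - (a + b)\<^sup>2) / real m ^ (?n + 1)"
  have E: "emeasure lborel (A \<union> B) = ennreal (a + b)"
    using A B \<open>A \<inter> B = {}\<close> by (simp add: plus_emeasure[symmetric] ennreal_plus)
  \<comment> \<open>A ball of radius m r has volume t \<ge> 4 a, while |A \<union> B| \<le> 2 a.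
    Hence both A and A \<union> B lose at least 3 a^2 at the coarse scale.\<close>
  have u1: "3 * a\<^sup>2 \<le> a * t - a\<^sup>2"
  proof -
    have "a * (4 * a) \<le> a * t" using t A by (intro mult_left_mono) auto
    then show ?thesis by (simp add: power2_eq_square)
  qed
  have v1: "3 * a\<^sup>2 \<le> (a + b) * t - (a + b)\<^sup>2"
  proof -
    have "0 \<le> b * (2 * a - b)" using A B \<open>b \<le> a\<close> by simp
    then have "3 * a\<^sup>2 \<le> (a + b) * (3 * a - b)"
      by (simp add: power2_eq_square algebra_simps)
    also have "\<dots> \<le> (a + b) * (t - (a + b))"
      using A B t \<open>b \<le> a\<close> by (intro mult_left_mono) auto
    finally show ?thesis by (simp add: algebra_simps power2_eq_square)
  qed
  have nonneg: "0 \<le> u" "0 \<le> v"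
    unfolding u_def v_def by (intro divide_nonneg_nonneg order.trans[OF _ u1] order.trans[OF _ v1]; simp)+
  have "ennreal u \<le> close_pairs A (- A) r"
    using close_pairs_compl_ge[of A a r m] A r m unfolding u_def t_def \<omega>_def by simp
  moreover have "ennreal v \<le> close_pairs (A \<union> B) (- (A \<union> B)) r"
    using close_pairs_compl_ge[of "A \<union> B" "a + b" r m] E A B r m unfolding v_def t_def \<omega>_def by simp
  ultimately have V: "ennreal ((u + v - b * (\<omega> * r ^ ?n)) / 2) \<le> close_pairs A (- (A \<union> B)) r"
    unfolding \<omega>_def using nonneg r B \<open>A \<inter> B = {}\<close> by (intro close_pairs_gap_ge) auto
  \<comment> \<open>A lower bound for the factor 1 / m^(n+1), coming from m \<le> 2 R / r.\<close>
  define q where "q = (r / (2 * R)) ^ (?n + 1)"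
  have q: "q * real m ^ (?n + 1) \<le> 1"
  proof -
    have "r / (2 * R) * real m \<le> 1" using m r \<open>0 < R\<close> by (simp add: field_simps)
    moreover have "0 \<le> r / (2 * R) * real m" using r \<open>0 < R\<close> by simp
    ultimately have "(r / (2 * R) * real m) ^ (?n + 1) \<le> 1" by (intro power_le_one)
    then show ?thesis by (simp only: q_def power_mult_distrib)
  qed
  have "0 \<le> q" using r \<open>0 < R\<close> by (simp add: q_def)
  have "6 * a\<^sup>2 * q \<le> u + v"
  proof -
    have "6 * a\<^sup>2 * (q * real m ^ (?n + 1)) \<le> 6 * a\<^sup>2"
      using q by (intro mult_left_le) auto
    also have "\<dots> \<le> (a * t - a\<^sup>2) + ((a + b) * t - (a + b)\<^sup>2)"
      using u1 v1 by linarith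
    finally show ?thesis
      using m unfolding u_def v_def add_divide_distrib[symmetric]
      by (subst pos_le_divide_eq) (auto simp: mult.assoc)
  qed
  \<comment> \<open>This is equivalent to the assumed lower bound on r. Of the 6 a^2 q gained, B
    removes at most 4 a^2 q, and half of the remaining 2 a^2 q is the claim.\<close>
  moreover have "b * (\<omega> * r ^ ?n) \<le> 4 * a\<^sup>2 * q"
  proof -
    have "2 ^ (?n + 1) * R * b \<le> r * a" using r A by (simp add: field_simps)
    then have "(2 ^ (?n + 1) * R * b) * (4 * a * r ^ ?n) \<le> (r * a) * (4 * a * r ^ ?n)"
      using A r by (intro mult_right_mono) auto
    moreover have "4 * a = \<omega> * R ^ ?n" using R by (simp add: \<omega>_def)
    ultimately have "(2 ^ (?n + 1) * R * b) * (\<omega> * R ^ ?n * r ^ ?n) \<le> (r * a) * (4 * a * r ^ ?n)"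
      by simp
    then have "(b * (\<omega> * r ^ ?n)) * (2 * R) ^ (?n + 1) \<le> 4 * a\<^sup>2 * r ^ (?n + 1)"
      by (simp add: power_mult_distrib power2_eq_square algebra_simps)
    then show ?thesis
      unfolding q_def power_divide times_divide_eq_right using \<open>0 < R\<close>
      by (subst pos_le_divide_eq) auto
  qed
  ultimately have "a\<^sup>2 * q \<le> (u + v - b * (\<omega> * r ^ ?n)) / 2" by simp
  then show ?thesis
    using V unfolding q_def by (meson ennreal_leI order.trans)
qed

lemma unit_ball_vol_nonzero [simp]: "unit_ball_vol (real n) \<noteq> 0"
  using unit_ball_vol_pos[OF of_nat_0_le_iff, of n] by (rule less_imp_neq[symmetric])

lemma power_Suc_DIM_powr:
  fixes x :: real
  assumes "0 < x"
  shows "x ^ (DIM('a::euclidean_space) + 1) = x powr (real DIM('a) + 1)"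
  using powr_realpow[OF assms, of "DIM('a) + 1"] by (simp add: add.commute)

text \<open>Fixes the length unit attached to |A|, with the factor 4 that
  \<open>close_pairs_intermediate_scale\<close> asks for. The formula for \<open>R powr q\<close>
  separates the dimensional constant from the power of a.\<close>

lemma radius_of_volume:
  fixes a :: real
  assumes "0 < a"
  obtains R where "0 < R" "unit_ball_vol DIM('a::euclidean_space) * R ^ DIM('a) = 4 * a"
    "\<And>q. R powr q = (4 / unit_ball_vol DIM('a)) powr (q / DIM('a)) * a powr (q / DIM('a))"
proof
  define \<omega> where "\<omega> = unit_ball_vol (real DIM('a))"
  define R where "R = (4 / \<omega> * a) powr (1 / real DIM('a))"
  have pos: "0 < \<omega>" by (simp add: \<omega>_def)
  show "0 < R" using pos assms by (simp add: R_def)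
  show "unit_ball_vol DIM('a) * R ^ DIM('a) = 4 * a"
    unfolding \<omega>_def[symmetric] using pos assms by (simp add: R_def powr_powr flip: powr_realpow)
  show "R powr q = (4 / unit_ball_vol DIM('a)) powr (q / DIM('a)) * a powr (q / DIM('a))" for q
    unfolding \<omega>_def[symmetric] using pos assms by (simp add: R_def powr_powr flip: powr_mult)
qed

text \<open>The kernel weight times the r^(n+1) of the boundary layer behaves like
  \<open>r powr (1 - 2 * s)\<close>, which for s > 1/2 is largest at the smallest scale. Evaluating
  at the smallest admissible scale alone therefore gives the right power.\<close>

lemma kernel_energy_ge_supercritical:
  fixes A :: "'a::euclidean_space set"
  assumes [measurable]: "A \<in> sets borel" "B \<in> sets borel" and disj: "A \<inter> B = {}"
    and A: "emeasure lborel A = ennreal a" "0 < a" and B: "emeasure lborel B = ennreal b" "0 < b"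
    and small: "2 ^ (DIM('a) + 1) * b \<le> a" and "0 < s"
  shows "ennreal ((4 / unit_ball_vol DIM('a)) powr (- (real DIM('a) + 2 * s) / real DIM('a))
      * 2 powr (- 2 * s * (real DIM('a) + 1))
      * (a powr ((real DIM('a) - 2 * s) / real DIM('a)) * (b / a) powr (1 - 2 * s)))
    \<le> kernel_energy (real DIM('a) + 2 * s) A (- (A \<union> B))"
proof -
  define n where "n = real DIM('a)"
  \<comment> \<open>The factor in the lower end of the admissible scales. In \<open>powr\<close>
    form, \<open>K powr (1 - 2 * s)\<close> divided by \<open>2 powr (n + 1)\<close> yields the
    second factor of the constant.\<close>
  define K :: real where "K = 2 powr (n + 1)"
  have "0 < n" by (simp add: n_def)
  have K: "K = 2 ^ (DIM('a) + 1)" "0 < K"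
    by (simp_all add: K_def n_def powr_realpow[symmetric] powr_add)
  obtain R where R: "0 < R" "unit_ball_vol DIM('a) * R ^ DIM('a) = 4 * a"
    "\<And>q. R powr q = (4 / unit_ball_vol DIM('a)) powr (q / n) * a powr (q / n)"
    using radius_of_volume[OF A(2), where 'a = 'a] unfolding n_def by blast
  define r where "r = K * R * (b / a)"
  have r: "0 < r" "r \<le> R" using K R A B small by (simp_all add: r_def field_simps)
  have "1 * b \<le> 2 ^ (DIM('a) + 1) * b" using B by (intro mult_right_mono one_le_power) auto
  then have "b \<le> a" using small by simp
  have "ennreal (r powr - (n + 2 * s) * (a\<^sup>2 * (r / (2 * R)) ^ (DIM('a) + 1)))
      \<le> ennreal (r powr - (n + 2 * s)) * close_pairs A (- (A \<union> B)) r"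
    using close_pairs_intermediate_scale[OF assms(1-5) B(1) _ \<open>b \<le> a\<close> R(1,2) r] B
    by (simp add: r_def K ennreal_mult' mult_left_mono)
  also have "\<dots> \<le> kernel_energy (n + 2 * s) A (- (A \<union> B))"
    using r \<open>0 < s\<close> \<open>0 < n\<close> by (intro close_pairs_le_kernel_energy) auto
  also have "(r / (2 * R)) ^ (DIM('a) + 1) = (r / (2 * R)) powr (n + 1)"
    unfolding n_def using r R by (intro power_Suc_DIM_powr) simp
  also have "r powr - (n + 2 * s) * (a\<^sup>2 * (r / (2 * R)) powr (n + 1))
      = a\<^sup>2 * (r powr (1 - 2 * s) / (2 powr (n + 1) * R powr (n + 1)))"
    using r R by (simp add: powr_divide powr_mult powr_add powr_diff powr_minus field_simps)
  also have "r powr (1 - 2 * s) = K powr (1 - 2 * s) * R powr (1 - 2 * s) * (b / a) powr (1 - 2 * s)"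
    using \<open>0 < K\<close> R(1) A(2) B(2) unfolding r_def by (subst powr_mult powr_mult)+ simp_all
  also have "a\<^sup>2 * (K powr (1 - 2 * s) * R powr (1 - 2 * s) * (b / a) powr (1 - 2 * s) / (2 powr (n + 1) * R powr (n + 1)))
     = a\<^sup>2 * (K powr (1 - 2 * s) / 2 powr (n + 1)) * (R powr (1 - 2 * s) / R powr (n + 1)) * (b / a) powr (1 - 2 * s)"
    by simp
  also have "R powr (1 - 2 * s) / R powr (n + 1) = R powr - (n + 2 * s)"
    by (simp add: powr_diff[symmetric] algebra_simps)
  also have "\<dots> = (4 / unit_ball_vol DIM('a)) powr (- (n + 2 * s) / n) * a powr (- (n + 2 * s) / n)"
    by (simp add: R(3))
  also have "K powr (1 - 2 * s) / 2 powr (n + 1) = 2 powr (- 2 * s * (n + 1))"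
    by (simp add: K_def powr_powr powr_diff[symmetric] algebra_simps)
  also have "a\<^sup>2 * 2 powr (- 2 * s * (n + 1)) *
       ((4 / unit_ball_vol DIM('a)) powr (- (n + 2 * s) / n) * a powr (- (n + 2 * s) / n)) * (b / a) powr (1 - 2 * s)
     = (4 / unit_ball_vol DIM('a)) powr (- (n + 2 * s) / n) * 2 powr (- 2 * s * (n + 1))
       * (a powr 2 * a powr (- (n + 2 * s) / n) * (b / a) powr (1 - 2 * s))"
    using A by simp
  also have "a powr 2 * a powr (- (n + 2 * s) / n) = a powr ((n - 2 * s) / n)"
    using \<open>0 < n\<close> by (simp add: powr_add[symmetric] field_simps)
  finally show ?thesis by (simp add: n_def)
qed

text \<open>For s = 1/2 the weighted lower bound is a multiple of 1 / r, so every dyadic scale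
  contributes equally and the integral over the admissible range is a logarithm.\<close>

lemma kernel_energy_ge_critical:
  fixes A :: "'a::euclidean_space set"
  assumes [measurable]: "A \<in> sets borel" "B \<in> sets borel" and disj: "A \<inter> B = {}"
    and A: "emeasure lborel A = ennreal a" "0 < a" and B: "emeasure lborel B = ennreal b" "0 < b"
    and small: "4 ^ (DIM('a) + 1) * b \<le> a"
  shows "ennreal ((real DIM('a) + 1) / 2 ^ (DIM('a) + 2)
      * (4 / unit_ball_vol DIM('a)) powr (- (real DIM('a) + 1) / real DIM('a))
      * (a powr ((real DIM('a) - 1) / real DIM('a)) * ln (a / b)))
    \<le> kernel_energy (real DIM('a) + 1) A (- (A \<union> B))"
proof -
  define n where "n = real DIM('a)"
  define K :: real where "K = 2 ^ (DIM('a) + 1)"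
  have "0 < n" by (simp add: n_def)
  have K: "0 < K" "1 \<le> K" "K * K = 4 ^ (DIM('a) + 1)"
    unfolding K_def power_mult_distrib[symmetric] by (simp_all del: power_Suc)
  obtain R where R: "0 < R" "unit_ball_vol DIM('a) * R ^ DIM('a) = 4 * a"
    "\<And>q. R powr q = (4 / unit_ball_vol DIM('a)) powr (q / n) * a powr (q / n)"
    using radius_of_volume[OF A(2), where 'a = 'a] unfolding n_def by blast
  have small': "K * (K * b) \<le> a" using small K by (simp add: mult.assoc[symmetric])
  have "1 * (K * b) \<le> K * (K * b)" using B K by (intro mult_right_mono) auto
  then have Kb: "K * b \<le> a" using small' by simp
  moreover have "1 * b \<le> K * b" using B K by (intro mult_right_mono) auto
  ultimately have "b \<le> a" by simp
  define r1 where "r1 = K * R * (b / a)"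
  have r1: "0 < r1" "r1 \<le> R" using K R A B Kb by (simp_all add: r1_def field_simps)
  \<comment> \<open>The coefficient for which the layer-cake integrand becomes C / r.\<close>
  define C where "C = (n + 1) * a\<^sup>2 / (2 * R) ^ (DIM('a) + 1)"
  have "0 \<le> C" using R \<open>0 < n\<close> by (simp add: C_def)
  have "ennreal (C * ln R - C * ln r1) \<le> kernel_energy (n + 1) A (- (A \<union> B))"
  proof (rule kernel_energy_layer_cake[where F = "\<lambda>r. C * ln r" and ?r1.0 = r1 and ?r2.0 = R and f = "\<lambda>r. a\<^sup>2 * (r / (2 * R)) ^ (DIM('a) + 1)"])
    fix r assume r: "r1 \<le> r" "r \<le> R"
    then have "0 < r" using r1 by simp
    show "ennreal (a\<^sup>2 * (r / (2 * R)) ^ (DIM('a) + 1)) \<le> close_pairs A (- (A \<union> B)) r"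
      using close_pairs_intermediate_scale[OF assms(1-5) B(1) _ \<open>b \<le> a\<close> R(1,2) \<open>0 < r\<close> r(2)] B r
      by (simp add: r1_def K_def)
    have "r powr (- (n + 1) - 1) * r ^ (DIM('a) + 1) = r powr (- (n + 1) - 1) * r powr (n + 1)"
      unfolding n_def power_Suc_DIM_powr[OF \<open>0 < r\<close>] ..
    also have "\<dots> = 1 / r" using \<open>0 < r\<close> by (simp add: powr_add[symmetric] powr_minus_divide)
    finally have "(n + 1) * r powr (- (n + 1) - 1) * (a\<^sup>2 * (r / (2 * R)) ^ (DIM('a) + 1)) = C / r"
      by (simp add: C_def power_divide ac_simps del: power_Suc power_add)
    then show "((\<lambda>r. C * ln r) has_real_derivative
       (n + 1) * r powr (- (n + 1) - 1) * (a\<^sup>2 * (r / (2 * R)) ^ (DIM('a) + 1))) (at r)"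
      using \<open>0 < r\<close> by (auto intro!: derivative_eq_intros)
  qed (use \<open>0 < n\<close> r1 R in \<open>auto intro!: continuous_intros\<close>)
  \<comment> \<open>Here ln (R / r1) = ln (a / b) - ln K. The hypothesis says a / b \<ge> K^2, so
    the subtracted term is at most half of ln (a / b).\<close>
  moreover have "C / 2 * ln (a / b) \<le> C * ln R - C * ln r1"
  proof -
    have "ln (K * K) \<le> ln (a / b)"
      using \<open>0 < K\<close> B(2) A(2) small' by (subst ln_le_cancel_iff) (auto simp: field_simps)
    then have "2 * ln K \<le> ln (a / b)" using \<open>0 < K\<close> by (simp add: ln_mult)
    moreover have "ln r1 = ln K + ln R - ln (a / b)"
      using K R A B by (simp add: r1_def ln_mult ln_div)
    ultimately have "ln (a / b) / 2 \<le> ln R - ln r1" by simp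
    then have "C * (ln (a / b) / 2) \<le> C * (ln R - ln r1)" using \<open>0 \<le> C\<close> by (rule mult_left_mono)
    then show ?thesis by (simp add: algebra_simps)
  qed
  ultimately have "ennreal (C / 2 * ln (a / b)) \<le> kernel_energy (n + 1) A (- (A \<union> B))"
    by (meson ennreal_leI order.trans)
  moreover have "C / 2 = (n + 1) / 2 ^ (DIM('a) + 2)
      * (4 / unit_ball_vol DIM('a)) powr (- (n + 1) / n) * a powr ((n - 1) / n)"
  proof -
    have "C / 2 = (n + 1) * a\<^sup>2 / 2 ^ (DIM('a) + 2) * (1 / R ^ (DIM('a) + 1))"
      by (simp add: C_def power_mult_distrib)
    also have "1 / R ^ (DIM('a) + 1) = R powr - (n + 1)"
      unfolding power_Suc_DIM_powr[OF R(1)] n_def by (rule powr_minus_divide[symmetric])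
    also have "R powr - (n + 1) = (4 / unit_ball_vol DIM('a)) powr (- (n + 1) / n) * a powr (- (n + 1) / n)"
      by (simp add: R(3))
    also have "(n + 1) * a\<^sup>2 / 2 ^ (DIM('a) + 2)
        * ((4 / unit_ball_vol DIM('a)) powr (- (n + 1) / n) * a powr (- (n + 1) / n))
      = (n + 1) / 2 ^ (DIM('a) + 2) * (4 / unit_ball_vol DIM('a)) powr (- (n + 1) / n)
        * (a powr 2 * a powr (- (n + 1) / n))"
      using A by simp
    also have "a powr 2 * a powr (- (n + 1) / n) = a powr ((n - 1) / n)"
      using \<open>0 < n\<close> by (simp add: powr_add[symmetric] field_simps)
    finally show ?thesis .
  qed
  ultimately show ?thesis by (simp add: n_def mult.assoc)
qed

section \<open>Sharp estimates on the line\<close>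

text \<open>The leading term r^2 is the value for a long interval, so no constant is lost to first
  order. The parameter c lets A and A \<union> B share the error term computed from |A|.\<close>

lemma close_pairs_compl_ge_line:
  fixes X :: "'a::euclidean_space set"
  assumes "DIM('a) = 1" and X: "X \<in> sets borel" "emeasure lborel X = ennreal x"
    and "0 < c" "c \<le> x" "0 < r"
  shows "ennreal (r\<^sup>2 - r ^ 4 / c\<^sup>2) \<le> close_pairs X (- X) r"
proof -
  define m where "m = nat \<lceil>x / r\<rceil>"
  have "0 < x" using assms by simp
  then have "0 < x / r" using \<open>0 < r\<close> by simp
  then have m: "0 < m" "x / r \<le> real m" "real m \<le> x / r + 1" unfolding m_def by linarith+
  \<comment> \<open>The overshoot of m r past x. In dimension one the ball has length 2 m r, so x *
    2 m r - x^2 = (m r)^2 - d^2, and only d \<le> r enters the error.\<close>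
  define d where "d = real m * r - x"
  have d: "0 \<le> d" "d \<le> r"
    using m \<open>0 < r\<close> by (simp_all add: d_def field_simps)
  have "r\<^sup>2 - r ^ 4 / c\<^sup>2 \<le> r\<^sup>2 - r ^ 4 / x\<^sup>2"
    using \<open>0 < c\<close> \<open>c \<le> x\<close> by (auto intro!: divide_left_mono power_mono mult_pos_pos)
  also have "\<dots> \<le> (x * (2 * (real m * r)) - x\<^sup>2) / (real m)\<^sup>2"
  proof -
    have "x \<le> real m * r" using m \<open>0 < r\<close> by (simp add: field_simps)
    then have "x\<^sup>2 \<le> (real m * r)\<^sup>2" using \<open>0 < x\<close> by (intro power_mono) auto
    then have "1 \<le> (real m * r)\<^sup>2 / x\<^sup>2" using \<open>0 < x\<close> by simp
    moreover have "d\<^sup>2 \<le> r\<^sup>2" using d by (intro power_mono)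
    ultimately have "1 * d\<^sup>2 \<le> (real m * r)\<^sup>2 / x\<^sup>2 * r\<^sup>2"
      by (intro mult_mono) auto
    moreover have "x * (2 * (real m * r)) - x\<^sup>2 = (real m * r)\<^sup>2 - d\<^sup>2"
      by (simp add: d_def power2_eq_square algebra_simps)
    moreover have "(r\<^sup>2 - r ^ 4 / x\<^sup>2) * (real m)\<^sup>2 = (real m * r)\<^sup>2 - (real m * r)\<^sup>2 / x\<^sup>2 * r\<^sup>2"
      by (simp add: field_simps power2_eq_square power4_eq_xxxx)
    ultimately show ?thesis using m by (subst pos_le_divide_eq) auto
  qed
  also have "ennreal \<dots> \<le> close_pairs X (- X) r"
    using close_pairs_compl_ge[of X x r m] X m \<open>0 < x\<close> \<open>0 < r\<close> \<open>DIM('a) = 1\<close> by (simp add: power2_eq_square)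
  finally show ?thesis by (simp add: ennreal_leI)
qed

text \<open>Integrating the sharp line bound keeps the coefficient (1 + 2s) / (2s (2s - 1)) of
  \<open>b powr (1 - 2 * s)\<close>, which exceeds 1 in this range of s; the single-scale bound does
  not track it.\<close>

lemma kernel_energy_ge_line:
  fixes A :: "'a::euclidean_space set"
  assumes "DIM('a) = 1" and [measurable]: "A \<in> sets borel" "B \<in> sets borel" and disj: "A \<inter> B = {}"
    and A: "emeasure lborel A = ennreal a" "0 < a" and B: "emeasure lborel B = ennreal b" "0 < b"
    and "b \<le> a" and s: "1/2 < s" "s < 1"
  shows "ennreal ((1 + 2 * s) * a powr (1 - 2 * s)
      * ((b / a) powr (1 - 2 * s) / (2 * s * (2 * s - 1)) - (1 / (2 * s - 1) + 1 / (3 - 2 * s))))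
    \<le> kernel_energy (1 + 2 * s) A (- (A \<union> B))"
proof -
  define p where "p = 1 + 2 * s"
  define F where "F r = p * (b * r powr (- 2 * s) / (2 * s) - r powr (1 - 2 * s) / (2 * s - 1)
      - r powr (3 - 2 * s) / ((3 - 2 * s) * a\<^sup>2))" for r
  have E: "emeasure lborel (A \<union> B) = ennreal (a + b)"
    using A B disj by (simp add: plus_emeasure[symmetric] ennreal_plus)
  have "ennreal (F a - F b) \<le> kernel_energy p A (- (A \<union> B))"
  \<comment> \<open>The range starts at b, where r^2 - r b becomes nonnegative. Near r = a the
    integrand is negative, which the layer cake tolerates.\<close>
  proof (rule kernel_energy_layer_cake[where F = F and ?r1.0 = b and ?r2.0 = a and f = "\<lambda>r. r\<^sup>2 - r * b - r ^ 4 / a\<^sup>2"])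
    fix r assume r: "b \<le> r" "r \<le> a"
    then have "0 < r" using B by simp
    have "r\<^sup>2 \<le> a\<^sup>2" using r \<open>0 < r\<close> by (intro power_mono) auto
    then have "r\<^sup>2 * r\<^sup>2 \<le> r\<^sup>2 * a\<^sup>2" by (rule mult_left_mono) simp
    then have "r\<^sup>2 * r\<^sup>2 / a\<^sup>2 \<le> r\<^sup>2" using A by (simp only: pos_divide_le_eq zero_less_power)
    then have u: "0 \<le> r\<^sup>2 - r ^ 4 / a\<^sup>2" by (simp add: power2_eq_square power4_eq_xxxx mult.assoc)
    have "ennreal ((r\<^sup>2 - r ^ 4 / a\<^sup>2 + (r\<^sup>2 - r ^ 4 / a\<^sup>2) - b * (unit_ball_vol DIM('a) * r ^ DIM('a))) / 2)
        \<le> close_pairs A (- (A \<union> B)) r"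
      using A(2) B u \<open>0 < r\<close> disj
        close_pairs_compl_ge_line[OF \<open>DIM('a) = 1\<close> _ A(1), of a r]
        close_pairs_compl_ge_line[OF \<open>DIM('a) = 1\<close> _ E, of a r]
      by (intro close_pairs_gap_ge) auto
    moreover have "(r\<^sup>2 - r ^ 4 / a\<^sup>2 + (r\<^sup>2 - r ^ 4 / a\<^sup>2) - b * (unit_ball_vol DIM('a) * r ^ DIM('a))) / 2
        = r\<^sup>2 - r * b - r ^ 4 / a\<^sup>2"
      unfolding \<open>DIM('a) = 1\<close> by simp
    ultimately show "ennreal (r\<^sup>2 - r * b - r ^ 4 / a\<^sup>2) \<le> close_pairs A (- (A \<union> B)) r"
      by (simp only:)
    have e: "- p - 1 + 2 = - 2 * s" "- p - 1 + 1 = - 2 * s - 1" "- p - 1 + 4 = 2 - 2 * s"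
      by (simp_all add: p_def)
    have "r powr (- p - 1) * (r\<^sup>2 - r * b - r ^ 4 / a\<^sup>2)
        = r powr (- p - 1) * r powr 2 - b * (r powr (- p - 1) * r powr 1)
          - r powr (- p - 1) * r powr 4 / a\<^sup>2"
      using \<open>0 < r\<close> by (simp add: algebra_simps)
    then have "r powr (- p - 1) * (r\<^sup>2 - r * b - r ^ 4 / a\<^sup>2)
        = r powr (- 2 * s) - b * r powr (- 2 * s - 1) - r powr (2 - 2 * s) / a\<^sup>2"
      unfolding powr_add[symmetric] e .
    then have eq: "p * r powr (- p - 1) * (r\<^sup>2 - r * b - r ^ 4 / a\<^sup>2)
        = p * (r powr (- 2 * s) - b * r powr (- 2 * s - 1) - r powr (2 - 2 * s) / a\<^sup>2)"
      by (simp only: mult.assoc)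
    show "(F has_real_derivative p * r powr (- p - 1) * (r\<^sup>2 - r * b - r ^ 4 / a\<^sup>2)) (at r)"
      unfolding F_def[abs_def] eq using \<open>0 < r\<close> s A
      by (auto intro!: derivative_eq_intros simp: divide_simps) (simp add: algebra_simps)
  qed (use s B \<open>b \<le> a\<close> A in \<open>auto intro!: continuous_intros simp: p_def\<close>)
  moreover have "(1 + 2 * s) * a powr (1 - 2 * s)
      * ((b / a) powr (1 - 2 * s) / (2 * s * (2 * s - 1)) - (1 / (2 * s - 1) + 1 / (3 - 2 * s)))
      \<le> F a - F b"
  proof -
    have b1: "b * b powr (- 2 * s) = b powr (1 - 2 * s)"
      using B powr_add[of b 1 "- 2 * s"] by simp
    have "a powr (3 - 2 * s) = a\<^sup>2 * a powr (1 - 2 * s)"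
      using A powr_add[of a 2 "1 - 2 * s"] by simp
    then have a1: "a powr (3 - 2 * s) / ((3 - 2 * s) * a\<^sup>2) = a powr (1 - 2 * s) / (3 - 2 * s)"
      using A by simp
    have "F a - F b = p * (b * a powr (- 2 * s) / (2 * s) + b powr (3 - 2 * s) / ((3 - 2 * s) * a\<^sup>2)
        + (b powr (1 - 2 * s) / (2 * s - 1) - b powr (1 - 2 * s) / (2 * s))
        - (a powr (1 - 2 * s) / (2 * s - 1) + a powr (1 - 2 * s) / (3 - 2 * s)))"
      unfolding F_def b1 a1 using A by (simp add: algebra_simps)
    also have "\<dots> \<ge> p * ((b powr (1 - 2 * s) / (2 * s - 1) - b powr (1 - 2 * s) / (2 * s))
        - (a powr (1 - 2 * s) / (2 * s - 1) + a powr (1 - 2 * s) / (3 - 2 * s)))"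
      using s A B by (intro mult_left_mono) (auto simp: p_def)
    also have "b powr (1 - 2 * s) / (2 * s - 1) - b powr (1 - 2 * s) / (2 * s)
        = b powr (1 - 2 * s) / (2 * s * (2 * s - 1))"
      using s by (simp add: field_simps)
    also have "b powr (1 - 2 * s) = a powr (1 - 2 * s) * (b / a) powr (1 - 2 * s)"
      using A B by (simp add: powr_divide)
    also have "p * (a powr (1 - 2 * s) * (b / a) powr (1 - 2 * s) / (2 * s * (2 * s - 1))
        - (a powr (1 - 2 * s) / (2 * s - 1) + a powr (1 - 2 * s) / (3 - 2 * s)))
      = (1 + 2 * s) * a powr (1 - 2 * s)
        * ((b / a) powr (1 - 2 * s) / (2 * s * (2 * s - 1)) - (1 / (2 * s - 1) + 1 / (3 - 2 * s)))"
      unfolding p_def by (simp add: right_diff_distrib distrib_left mult.assoc)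
    finally show ?thesis .
  qed
  ultimately show ?thesis
    unfolding p_def by (meson ennreal_leI order.trans)
qed

section \<open>Uniform constants for the two regimes\<close>

definition disjoint_volumes :: "'a::euclidean_space set \<Rightarrow> 'a set \<Rightarrow> real \<Rightarrow> real \<Rightarrow> bool" where
  "disjoint_volumes A B a b \<longleftrightarrow> A \<in> sets borel \<and> B \<in> sets borel \<and> A \<inter> B = {} \<and>
     emeasure lborel A = ennreal a \<and> 0 < a \<and> emeasure lborel B = ennreal b \<and> 0 \<le> b"

lemma far_bound:
  fixes s :: real
  assumes "0 < s"
  obtains C where "0 < C"
    "\<And>(A :: 'a::euclidean_space set) B a b. disjoint_volumes A B a b \<Longrightarrow>
       ennreal (C * (a * (a + b) powr (- 2 * s / real DIM('a))))
         \<le> kernel_energy (real DIM('a) + 2 * s) A (- (A \<union> B))"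
proof
  show "0 < (2 / unit_ball_vol DIM('a)) powr (- (real DIM('a) + 2 * s) / real DIM('a))"
    by simp
  fix A B :: "'a set" and a b
  assume "disjoint_volumes A B a b"
  then show "ennreal ((2 / unit_ball_vol DIM('a)) powr (- (real DIM('a) + 2 * s) / real DIM('a))
      * (a * (a + b) powr (- 2 * s / real DIM('a))))
    \<le> kernel_energy (real DIM('a) + 2 * s) A (- (A \<union> B))"
    unfolding disjoint_volumes_def using assms by (intro kernel_energy_ge_far) blast+
qed

text \<open>If b \<ge> \<delta> a with \<delta> \<le> 1, then a + b \<le> (2 / \<delta>) b. The
  dependence on \<delta> stays explicit because \<delta> may be the constant that is still to be
  chosen.\<close>

lemma far_bound_large_B:
  fixes s :: real
  assumes "0 < s"
  obtains C where "0 < C"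
    "\<And>(A :: 'a::euclidean_space set) B a b \<delta>. disjoint_volumes A B a b \<Longrightarrow> 0 < \<delta> \<Longrightarrow> \<delta> \<le> 1 \<Longrightarrow> \<delta> * a \<le> b \<Longrightarrow>
       ennreal (C * \<delta> powr (2 * s / real DIM('a)) * (a * b powr (- 2 * s / real DIM('a))))
         \<le> kernel_energy (real DIM('a) + 2 * s) A (- (A \<union> B))"
proof -
  obtain C where C: "0 < C"
    "\<And>(A :: 'a set) B a b. disjoint_volumes A B a b \<Longrightarrow>
       ennreal (C * (a * (a + b) powr (- 2 * s / real DIM('a))))
         \<le> kernel_energy (real DIM('a) + 2 * s) A (- (A \<union> B))"
    using far_bound[OF assms] by blast
  define q where "q = 2 * s / real DIM('a)"
  have "0 < q" using assms by (simp add: q_def)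
  show ?thesis
  proof (rule that)
    show "0 < C * 2 powr - q" using C by simp
    fix A B :: "'a set" and a b \<delta>
    assume AB: "disjoint_volumes A B a b" and \<delta>: "0 < \<delta>" "\<delta> \<le> 1" "\<delta> * a \<le> b"
    then have "0 < a" by (simp add: disjoint_volumes_def)
    then have "0 < b" using mult_pos_pos[OF \<delta>(1)] \<delta>(3) by (meson less_le_trans)
    have "\<delta> * b \<le> 1 * b" using \<delta> \<open>0 < b\<close> by (intro mult_right_mono) auto
    then have "\<delta> * (a + b) \<le> 2 * b" using \<delta> by (simp add: distrib_left)
    then have "a + b \<le> 2 / \<delta> * b" using \<delta> by (simp add: field_simps)
    then have "(2 / \<delta> * b) powr - q \<le> (a + b) powr - q"
      using \<open>0 < q\<close> \<open>0 < a\<close> \<open>0 < b\<close> by (intro powr_mono2') auto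
    moreover have "(2 / \<delta> * b) powr - q = 2 powr - q * \<delta> powr q * b powr - q"
      using \<delta> \<open>0 < b\<close> by (simp add: powr_mult powr_divide powr_minus field_simps)
    ultimately have "C * (a * (2 powr - q * \<delta> powr q * b powr - q)) \<le> C * (a * (a + b) powr - q)"
      using C(1) \<open>0 < a\<close> by (intro mult_left_mono) auto
    then have "ennreal (C * 2 powr - q * \<delta> powr q * (a * b powr - q))
        \<le> ennreal (C * (a * (a + b) powr - q))"
      by (intro ennreal_leI) (simp add: ac_simps)
    also have "\<dots> \<le> kernel_energy (real DIM('a) + 2 * s) A (- (A \<union> B))"
      using C(2)[OF AB] by (simp add: q_def)
    finally show "ennreal (C * 2 powr - q * \<delta> powr (2 * s / real DIM('a)) * (a * b powr (- 2 * s / real DIM('a))))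
         \<le> kernel_energy (real DIM('a) + 2 * s) A (- (A \<union> B))"
      by (simp add: q_def)
  qed
qed

text \<open>The constant 1 here is essential: on the line \<open>2 * s \<ge> 1\<close>, so \<open>c powr (2 * s) \<le> c\<close> and shrinking
  \<open>c\<close> does not rescue the second regime near \<open>|B| = c |A|\<close>.\<close>

lemma line_unit_constant:
  fixes s :: real
  assumes n1: "DIM('a::euclidean_space) = 1" and s: "1/2 \<le> s" "s < 1"
  obtains \<beta> where "0 < \<beta>" "\<beta> \<le> 1"
    "\<And>(A :: 'a set) B a b. disjoint_volumes A B a b \<Longrightarrow> 0 < b \<Longrightarrow> b \<le> \<beta> * a \<Longrightarrow>
       ennreal (b powr (1 - 2 * s)) \<le> kernel_energy (real DIM('a) + 2 * s) A (- (A \<union> B))"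
proof (cases "s = 1/2")
  case True
  show ?thesis
  proof (rule that)
    \<comment> \<open>In dimension one \<open>kernel_energy_ge_critical\<close> needs 16 b \<le> a
      and has constant 1/16; the factor exp (-16) makes ln (a / b) \<ge> 16, which compensates it.
      The target \<open>b powr (1 - 2 * s)\<close> is 1 here.\<close>
    show "0 < min (1/16) (exp (-16::real))" "min (1/16) (exp (-16)) \<le> (1::real)" by simp_all
    fix A B :: "'a set" and a b
    assume AB: "disjoint_volumes A B a b" and b: "0 < b" "b \<le> min (1/16) (exp (-16)) * a"
    then have "0 < a" by (simp add: disjoint_volumes_def)
    have "b \<le> 1/16 * a" "b \<le> exp (-16) * a"
      by (rule order.trans[OF b(2) mult_right_mono]; use \<open>0 < a\<close> in simp)+
    then have "16 * b \<le> a" "exp 16 \<le> a / b"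
      using b(1) by (simp_all add: exp_minus field_simps)
    then have ln: "16 \<le> ln (a / b)"
      using b(1) \<open>0 < a\<close> by (simp add: ln_ge_iff)
    have s1: "1 + 2 * s = 2" "1 - 2 * s = 0" using True by simp_all
    have "ennreal (1 / 16 * ln (a / b)) \<le> kernel_energy (real DIM('a) + 2 * s) A (- (A \<union> B))"
      using kernel_energy_ge_critical[of A B a b] AB b(1) n1 \<open>16 * b \<le> a\<close> \<open>0 < a\<close> True
      by (simp add: disjoint_volumes_def powr_minus s1(1))
    moreover have "ennreal (b powr (1 - 2 * s)) \<le> ennreal (1 / 16 * ln (a / b))"
      unfolding s1 using b(1) ln by (intro ennreal_leI) simp
    ultimately show "ennreal (b powr (1 - 2 * s)) \<le> kernel_energy (real DIM('a) + 2 * s) A (- (A \<union> B))"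
      by (rule order.trans[rotated])
  qed
next
  case False
  then have s': "1/2 < s" using s by simp
  \<comment> \<open>K collects the error terms of the line estimate, \<kappa> is the surplus of its
    leading coefficient over 1, and T is the size of \<open>(b / a) powr (1 - 2 * s)\<close> from
    which the surplus absorbs the error.\<close>
  define K where "K = 1 / (2 * s - 1) + 1 / (3 - 2 * s)"
  define \<kappa> where "\<kappa> = (1 + 2 * s) / (2 * s * (2 * s - 1)) - 1"
  define T where "T = (1 + 2 * s) * K / \<kappa>"
  have "0 < K" using s s' by (simp add: K_def add_pos_pos)
  have "2 * s * (2 * s - 1) < 2 * (2 * s - 1)"
    using s s' by (intro mult_strict_right_mono) auto
  also have "\<dots> < 1 + 2 * s" using s by simp
  finally have "0 < \<kappa>" using s' by (simp add: \<kappa>_def)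
  then have "0 < T" using \<open>0 < K\<close> s by (simp add: T_def)
  show ?thesis
  proof (rule that)
    \<comment> \<open>As 1 - 2s < 0, small b / a means large
      \<open>(b / a) powr (1 - 2 * s)\<close>; this threshold is where that power reaches T.\<close>
    let ?\<beta> = "min 1 (T powr (1 / (1 - 2 * s)))"
    show "0 < ?\<beta>" "?\<beta> \<le> 1" using \<open>0 < T\<close> by simp_all
    fix A B :: "'a set" and a b
    assume AB: "disjoint_volumes A B a b" and b: "0 < b" "b \<le> ?\<beta> * a"
    then have "0 < a" by (simp add: disjoint_volumes_def)
    have "b \<le> 1 * a" "b \<le> T powr (1 / (1 - 2 * s)) * a"
      by (rule order.trans[OF b(2) mult_right_mono]; use \<open>0 < a\<close> in simp)+
    then have "b \<le> a" and ba: "b / a \<le> T powr (1 / (1 - 2 * s))"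
      using \<open>0 < a\<close> by (simp_all add: field_simps)
    define X where "X = (b / a) powr (1 - 2 * s)"
    have "(T powr (1 / (1 - 2 * s))) powr (1 - 2 * s) \<le> X"
      unfolding X_def using ba s' b(1) \<open>0 < a\<close> by (intro powr_mono2') auto
    then have "T \<le> X" using \<open>0 < T\<close> s' by (simp add: powr_powr)
    then have "(1 + 2 * s) * K \<le> \<kappa> * X"
      using \<open>0 < \<kappa>\<close> by (simp add: T_def field_simps)
    then have "X \<le> (1 + 2 * s) * (X / (2 * s * (2 * s - 1)) - K)"
      by (simp add: \<kappa>_def algebra_simps)
    then have "a powr (1 - 2 * s) * X
        \<le> a powr (1 - 2 * s) * ((1 + 2 * s) * (X / (2 * s * (2 * s - 1)) - K))"
      by (intro mult_left_mono) auto
    moreover have "a powr (1 - 2 * s) * X = b powr (1 - 2 * s)"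
      using \<open>0 < a\<close> b(1) by (simp add: X_def powr_divide)
    ultimately have "b powr (1 - 2 * s)
        \<le> (1 + 2 * s) * a powr (1 - 2 * s) * (X / (2 * s * (2 * s - 1)) - K)"
      by (simp add: ac_simps)
    moreover have "ennreal ((1 + 2 * s) * a powr (1 - 2 * s) * (X / (2 * s * (2 * s - 1)) - K))
        \<le> kernel_energy (1 + 2 * s) A (- (A \<union> B))"
      using kernel_energy_ge_line[of A B a b s] AB b(1) \<open>b \<le> a\<close> n1 s s'
      by (simp add: disjoint_volumes_def X_def K_def)
    ultimately show "ennreal (b powr (1 - 2 * s)) \<le> kernel_energy (real DIM('a) + 2 * s) A (- (A \<union> B))"
      unfolding n1 of_nat_1 by (meson ennreal_leI order.trans)
  qed
qed

text \<open>With \<delta> = c the far bound has constant C c^q, q = 2s/n, which dominates c for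
  small c if q < 1. Otherwise the space is the line and the unit constant takes over for small b.
  The bound holds for all c \<le> c2, so c may be shrunk later although the condition c a < b then
  weakens.\<close>

lemma second_regime:
  fixes s :: real
  assumes "0 < s" "s < 1"
  obtains c2 where "0 < c2"
    "\<And>(A :: 'a::euclidean_space set) B a b c. disjoint_volumes A B a b \<Longrightarrow> 0 < c \<Longrightarrow> c \<le> c2 \<Longrightarrow> c * a < b \<Longrightarrow>
       ennreal (c * (a * b powr (- 2 * s / real DIM('a))))
         \<le> kernel_energy (real DIM('a) + 2 * s) A (- (A \<union> B))"
proof -
  define q where "q = 2 * s / real DIM('a)"
  have "0 < q" using assms by (simp add: q_def)
  obtain C where C: "0 < C"
    "\<And>(A :: 'a set) B a b \<delta>. disjoint_volumes A B a b \<Longrightarrow> 0 < \<delta> \<Longrightarrow> \<delta> \<le> 1 \<Longrightarrow> \<delta> * a \<le> b \<Longrightarrow>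
       ennreal (C * \<delta> powr q * (a * b powr - q))
         \<le> kernel_energy (real DIM('a) + 2 * s) A (- (A \<union> B))"
    using far_bound_large_B[OF assms(1)] unfolding q_def by auto
  show ?thesis
  proof (cases "q < 1")
    case True
    show ?thesis
    proof (rule that)
      \<comment> \<open>For c below this value, c^(1-q) \<le> C, that is c \<le> C c^q.\<close>
      let ?c2 = "min 1 (C powr (1 / (1 - q)))"
      show "0 < ?c2" using C(1) by simp
      fix A B :: "'a set" and a b c
      assume AB: "disjoint_volumes A B a b" and c: "0 < c" "c \<le> ?c2" "c * a < b"
      have "c powr (1 - q) \<le> (C powr (1 / (1 - q))) powr (1 - q)"
        using c True by (intro powr_mono2) auto
      then have "c powr (1 - q) \<le> C" using C(1) True by (simp add: powr_powr)
      then have "c powr (1 - q) * c powr q \<le> C * c powr q" by (intro mult_right_mono) auto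
      then have "c \<le> C * c powr q" using c(1) by (simp flip: powr_add)
      moreover have "0 < a" using AB by (simp add: disjoint_volumes_def)
      ultimately have "ennreal (c * (a * b powr - q)) \<le> ennreal (C * c powr q * (a * b powr - q))"
        by (intro ennreal_leI mult_right_mono) auto
      also have "\<dots> \<le> kernel_energy (real DIM('a) + 2 * s) A (- (A \<union> B))"
        using c by (intro C(2) AB) auto
      finally show "ennreal (c * (a * b powr (- 2 * s / real DIM('a))))
         \<le> kernel_energy (real DIM('a) + 2 * s) A (- (A \<union> B))"
        by (simp add: q_def)
    qed
  next
    case False
    then have "real DIM('a) \<le> 2 * s" by (simp add: q_def)
    then have "real DIM('a) < 2" using assms by simp
    moreover have "0 < DIM('a)" by simp
    ultimately have n1: "DIM('a) = 1" by linarith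
    have s2: "1/2 \<le> s" "q = 2 * s" using \<open>real DIM('a) \<le> 2 * s\<close> n1 by (simp_all add: q_def)
    obtain \<beta> where \<beta>: "0 < \<beta>" "\<beta> \<le> 1"
      "\<And>(A :: 'a set) B a b. disjoint_volumes A B a b \<Longrightarrow> 0 < b \<Longrightarrow> b \<le> \<beta> * a \<Longrightarrow>
         ennreal (b powr (1 - 2 * s)) \<le> kernel_energy (real DIM('a) + 2 * s) A (- (A \<union> B))"
      using line_unit_constant[OF n1 s2(1) assms(2)] by blast
    show ?thesis
    proof (rule that)
      show "0 < C * \<beta> powr q" using C(1) \<beta> by simp
      fix A B :: "'a set" and a b c
      assume AB: "disjoint_volumes A B a b" and c: "0 < c" "c \<le> C * \<beta> powr q" "c * a < b"
      have "0 < a" using AB by (simp add: disjoint_volumes_def)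
      then have "0 < b" using mult_pos_pos[OF c(1)] c(3) by (meson less_trans)
      have "ennreal (c * (a * b powr - q)) \<le> kernel_energy (real DIM('a) + 2 * s) A (- (A \<union> B))"
      \<comment> \<open>For small b, the hypothesis c a < b gives c a b^(-q) \<le> b^(1-2s), met by
        the unit constant. For larger b the far bound applies with the fixed \<delta> =
        \<beta>.\<close>
      proof (cases "b \<le> \<beta> * a")
        case True
        have "(c * a) * b powr - q \<le> b powr 1 * b powr - q"
          using c(3) \<open>0 < b\<close> by (intro mult_right_mono) auto
        also have "\<dots> = b powr (1 - 2 * s)" unfolding powr_add[symmetric] s2(2) by simp
        finally have "ennreal (c * (a * b powr - q)) \<le> ennreal (b powr (1 - 2 * s))"
          by (intro ennreal_leI) (simp add: mult.assoc)
        also have "\<dots> \<le> kernel_energy (real DIM('a) + 2 * s) A (- (A \<union> B))"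
          by (rule \<beta>(3)[OF AB \<open>0 < b\<close> True])
        finally show ?thesis .
      next
        case False
        have "ennreal (c * (a * b powr - q)) \<le> ennreal (C * \<beta> powr q * (a * b powr - q))"
          using c \<open>0 < a\<close> by (intro ennreal_leI mult_right_mono) auto
        also have "\<dots> \<le> kernel_energy (real DIM('a) + 2 * s) A (- (A \<union> B))"
          using False \<beta> by (intro C(2) AB) auto
        finally show ?thesis .
      qed
      then show "ennreal (c * (a * b powr (- 2 * s / real DIM('a))))
         \<le> kernel_energy (real DIM('a) + 2 * s) A (- (A \<union> B))"
        by (simp add: q_def)
    qed
  qed
qed

definition small_B_profile :: "real \<Rightarrow> real \<Rightarrow> real \<Rightarrow> real \<Rightarrow> real" where
  "small_B_profile n s a b =
    (if s < 1/2 then a powr ((n - 2 * s) / n)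
     else if s = 1/2 then a powr ((n - 1) / n) * ln (a / b)
     else a powr ((n - 2 * s) / n) * (b / a) powr (1 - 2 * s))"

text \<open>Needed to shrink the constant in front of the profile.\<close>

lemma small_B_profile_nonneg:
  assumes "0 < a" "0 \<le> b" "b \<le> a"
  shows "0 \<le> small_B_profile n s a b"
proof -
  have "0 \<le> ln (a / b)"
    using assms by (cases "b = 0") (auto intro: ln_ge_zero)
  then show ?thesis by (simp add: small_B_profile_def)
qed

lemma first_regime:
  fixes s :: real
  assumes "0 < s"
  obtains c1 where "0 < c1" "c1 \<le> 1"
    "\<And>(A :: 'a::euclidean_space set) B a b. disjoint_volumes A B a b \<Longrightarrow> b \<le> c1 * a \<Longrightarrow>
       ennreal (c1 * small_B_profile (real DIM('a)) s a b)
         \<le> kernel_energy (real DIM('a) + 2 * s) A (- (A \<union> B))"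
proof -
  define n where "n = real DIM('a)"
  have "0 < n" by (simp add: n_def)
  have "\<exists>\<delta> C. 0 < \<delta> \<and> \<delta> \<le> 1 \<and> 0 < C \<and> (\<forall>(A :: 'a set) B a b. disjoint_volumes A B a b \<longrightarrow> b \<le> \<delta> * a \<longrightarrow>
       ennreal (C * small_B_profile n s a b) \<le> kernel_energy (n + 2 * s) A (- (A \<union> B)))"
  proof (cases s "1/2 :: real" rule: linorder_cases)
    case less
    obtain C where C: "0 < C"
      "\<And>(A :: 'a set) B a b. disjoint_volumes A B a b \<Longrightarrow>
         ennreal (C * (a * (a + b) powr (- 2 * s / n))) \<le> kernel_energy (n + 2 * s) A (- (A \<union> B))"
      using far_bound[OF assms] unfolding n_def by blast
    show ?thesis
    proof (intro exI conjI allI impI)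
      show "0 < C * 2 powr (- 2 * s / n)" "0 < (1::real)" "(1::real) \<le> 1" using C by simp_all
      fix A B :: "'a set" and a b
      assume AB: "disjoint_volumes A B a b" and b: "b \<le> 1 * a"
      have a: "0 < a" "0 \<le> b" using AB by (simp_all add: disjoint_volumes_def)
      \<comment> \<open>For s < 1/2 the far bound suffices: a + b \<le> 2 a and the exponent is
        negative.\<close>
      have "(2 * a) powr (- 2 * s / n) \<le> (a + b) powr (- 2 * s / n)"
        using a b \<open>0 < n\<close> assms by (intro powr_mono2') auto
      then have "C * (a powr 1 * (2 * a) powr (- 2 * s / n)) \<le> C * (a * (a + b) powr (- 2 * s / n))"
        using a C(1) by (intro mult_left_mono) auto
      moreover have "a powr 1 * (2 * a) powr (- 2 * s / n) = 2 powr (- 2 * s / n) * a powr ((n - 2 * s) / n)"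
      proof -
        have "a powr ((n - 2 * s) / n) = a powr (1 + - 2 * s / n)"
          using \<open>0 < n\<close> by (simp add: diff_divide_distrib)
        then show ?thesis using a by (simp only: powr_add powr_mult ac_simps)
      qed
      ultimately have "C * 2 powr (- 2 * s / n) * small_B_profile n s a b \<le> C * (a * (a + b) powr (- 2 * s / n))"
        using less by (simp add: small_B_profile_def mult.assoc)
      then show "ennreal (C * 2 powr (- 2 * s / n) * small_B_profile n s a b)
          \<le> kernel_energy (n + 2 * s) A (- (A \<union> B))"
        using C(2)[OF AB] by (meson ennreal_leI order.trans)
    qed
  next
    case equal
    show ?thesis
    proof (intro exI conjI allI impI)
      let ?\<delta> = "1 / 4 ^ (DIM('a) + 1) :: real"
      let ?C = "(n + 1) / 2 ^ (DIM('a) + 2) * (4 / unit_ball_vol DIM('a)) powr (- (n + 1) / n)"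
      have "(1::real) \<le> 4 ^ (DIM('a) + 1)" by (rule one_le_power) simp
      then show "0 < ?\<delta>" "?\<delta> \<le> 1" "0 < ?C" using \<open>0 < n\<close> by simp_all
      fix A B :: "'a set" and a b
      assume AB: "disjoint_volumes A B a b" and b: "b \<le> ?\<delta> * a"
      show "ennreal (?C * small_B_profile n s a b) \<le> kernel_energy (n + 2 * s) A (- (A \<union> B))"
      \<comment> \<open>By the conventions for division and \<open>ln\<close> at 0 the profile is 0
        here, so the claim is trivial.\<close>
      proof (cases "b = 0")
        case True
        then show ?thesis using equal by (simp add: small_B_profile_def)
      next
        case False
        then show ?thesis
          using kernel_energy_ge_critical[of A B a b] AB b equal
          by (simp add: disjoint_volumes_def small_B_profile_def n_def field_simps)
      qed
    qed
  next
    case greater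
    show ?thesis
    proof (intro exI conjI allI impI)
      let ?\<delta> = "1 / 2 ^ (DIM('a) + 1) :: real"
      let ?C = "(4 / unit_ball_vol DIM('a)) powr (- (n + 2 * s) / n) * 2 powr (- 2 * s * (n + 1))"
      have "(1::real) \<le> 2 ^ (DIM('a) + 1)" by (rule one_le_power) simp
      then show "0 < ?\<delta>" "?\<delta> \<le> 1" "0 < ?C" by simp_all
      fix A B :: "'a set" and a b
      assume AB: "disjoint_volumes A B a b" and b: "b \<le> ?\<delta> * a"
      show "ennreal (?C * small_B_profile n s a b) \<le> kernel_energy (n + 2 * s) A (- (A \<union> B))"
      proof (cases "b = 0")
        case True
        then show ?thesis using greater by (simp add: small_B_profile_def)
      next
        case False
        moreover have "2 ^ (DIM('a) + 1) * b \<le> a" using b by (simp add: field_simps)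
        ultimately show ?thesis
          using kernel_energy_ge_supercritical[of A B a b s] AB greater
          by (simp add: disjoint_volumes_def small_B_profile_def n_def)
      qed
    qed
  qed
  then obtain \<delta> C where \<delta>: "0 < \<delta>" "\<delta> \<le> 1" "0 < C" and main:
    "\<And>(A :: 'a set) B a b. disjoint_volumes A B a b \<Longrightarrow> b \<le> \<delta> * a \<Longrightarrow>
       ennreal (C * small_B_profile n s a b) \<le> kernel_energy (n + 2 * s) A (- (A \<union> B))"
    by blast
  show ?thesis
  proof (rule that)
    \<comment> \<open>One number has to act both as the threshold for b / a and as the
      constant.\<close>
    let ?c = "min \<delta> C"
    show "0 < ?c" "?c \<le> 1" using \<delta> by auto
    fix A B :: "'a set" and a b
    assume AB: "disjoint_volumes A B a b" and b: "b \<le> ?c * a"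
    have a: "0 < a" "0 \<le> b" using AB by (simp_all add: disjoint_volumes_def)
    have "?c * a \<le> \<delta> * a" "\<delta> * a \<le> 1 * a" using a \<delta> by (intro mult_right_mono; simp)+
    then have "b \<le> \<delta> * a" "b \<le> a" using b by linarith+
    then have "?c * small_B_profile n s a b \<le> C * small_B_profile n s a b"
      using small_B_profile_nonneg a by (intro mult_right_mono) auto
    then show "ennreal (?c * small_B_profile (real DIM('a)) s a b)
         \<le> kernel_energy (real DIM('a) + 2 * s) A (- (A \<union> B))"
      using main[OF AB \<open>b \<le> \<delta> * a\<close>] unfolding n_def by (meson ennreal_leI order.trans)
  qed
qed

section \<open>A common constant for both regimes and arbitrary Lebesgue sets\<close>

theorem theorem1p6:
  fixes s :: real
  assumes "0 < s" and "s < 1"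
  shows "\<exists>c::real. 0 < c \<and> c < 1 \<and>
    (\<forall>A B :: ('a::euclidean_space) set.
       A \<in> sets lebesgue \<longrightarrow> B \<in> sets lebesgue \<longrightarrow> A \<inter> B = {} \<longrightarrow>
       emeasure lebesgue A < \<infinity> \<longrightarrow> emeasure lebesgue B < \<infinity> \<longrightarrow>
       ((measure lebesgue B \<le> c * measure lebesgue A \<and> 0 < measure lebesgue A \<longrightarrow>
          Lint s A (UNIV - (A \<union> B)) \<ge> ennreal
            (if s < 1/2 then c * measure lebesgue A powr ((real DIM('a) - 2 * s) / real DIM('a))
             else if s = 1/2 then c * measure lebesgue A powr ((real DIM('a) - 1) / real DIM('a))
                      * ln (measure lebesgue A / measure lebesgue B)
             else c * measure lebesgue A powr ((real DIM('a) - 2 * s) / real DIM('a))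
                      * (measure lebesgue B / measure lebesgue A) powr (1 - 2 * s)))
        \<and>
        (measure lebesgue B > c * measure lebesgue A \<longrightarrow>
          Lint s A (UNIV - (A \<union> B)) \<ge> ennreal
            (c * measure lebesgue A powr ((real DIM('a) - 2 * s) / real DIM('a))
               * (measure lebesgue B / measure lebesgue A) powr (- 2 * s / real DIM('a))))))"
proof -
  obtain c1 where c1: "0 < c1" "c1 \<le> 1" and first:
    "\<And>(A :: 'a set) B a b. disjoint_volumes A B a b \<Longrightarrow> b \<le> c1 * a \<Longrightarrow>
       ennreal (c1 * small_B_profile (real DIM('a)) s a b)
         \<le> kernel_energy (real DIM('a) + 2 * s) A (- (A \<union> B))"
    using first_regime[OF assms(1)] by blast
  obtain c2 where c2: "0 < c2" and second:
    "\<And>(A :: 'a set) B a b c. disjoint_volumes A B a b \<Longrightarrow> 0 < c \<Longrightarrow> c \<le> c2 \<Longrightarrow> c * a < b \<Longrightarrow>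
       ennreal (c * (a * b powr (- 2 * s / real DIM('a))))
         \<le> kernel_energy (real DIM('a) + 2 * s) A (- (A \<union> B))"
    using second_regime[OF assms] by blast
  \<comment> \<open>The entry 1/2 forces c < 1; shrinking c1 and c2 to a common value is allowed in
    both regimes.\<close>
  define c where "c = min (1/2) (min c1 c2)"
  have c: "0 < c" "c < 1" "c \<le> c1" "c \<le> c2" using c1 c2 by (auto simp: c_def)
  show ?thesis
  proof (intro exI[of _ c] conjI allI impI c(1,2))
    fix A B :: "'a set"
    assume AB: "A \<in> sets lebesgue" "B \<in> sets lebesgue" "A \<inter> B = {}"
      "emeasure lebesgue A < \<infinity>" "emeasure lebesgue B < \<infinity>"
    define a where "a = measure lebesgue A"
    define b where "b = measure lebesgue B"
    have nonneg: "0 \<le> a" "0 \<le> b" by (simp_all add: a_def b_def)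
    obtain A' B' :: "'a set" where disj: "A' \<in> sets borel" "B' \<in> sets borel" "A' \<inter> B' = {}"
      "emeasure lborel A' = ennreal a" "emeasure lborel B' = ennreal b"
      and Lint: "kernel_energy (real DIM('a) + 2 * s) A' (- (A' \<union> B')) \<le> Lint s A (UNIV - (A \<union> B))"
      using Lint_ge_kernel_energy[OF AB(1,4,2,5,3), of s] unfolding a_def b_def by blast
    have vol: "disjoint_volumes A' B' a b" if "0 < a"
      using disj nonneg that by (simp add: disjoint_volumes_def)
    {
      assume "measure lebesgue B \<le> c * measure lebesgue A \<and> 0 < measure lebesgue A"
      then have ab: "b \<le> c * a" "0 < a" by (simp_all add: a_def b_def)
      have "c * a \<le> c1 * a" "c1 * a \<le> 1 * a" using ab c c1 by (intro mult_right_mono; simp)+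
      then have "b \<le> c1 * a" "b \<le> a" using ab by linarith+
      have "ennreal (c * small_B_profile (real DIM('a)) s a b)
          \<le> ennreal (c1 * small_B_profile (real DIM('a)) s a b)"
        using c small_B_profile_nonneg[OF ab(2) nonneg(2) \<open>b \<le> a\<close>]
        by (intro ennreal_leI mult_right_mono) auto
      also have "\<dots> \<le> Lint s A (UNIV - (A \<union> B))"
        using first[OF vol[OF ab(2)] \<open>b \<le> c1 * a\<close>] Lint by (rule order.trans)
      finally show "ennreal
            (if s < 1/2 then c * measure lebesgue A powr ((real DIM('a) - 2 * s) / real DIM('a))
             else if s = 1/2 then c * measure lebesgue A powr ((real DIM('a) - 1) / real DIM('a))
                      * ln (measure lebesgue A / measure lebesgue B)
             else c * measure lebesgue A powr ((real DIM('a) - 2 * s) / real DIM('a))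
                      * (measure lebesgue B / measure lebesgue A) powr (1 - 2 * s))
          \<le> Lint s A (UNIV - (A \<union> B))"
        by (simp add: small_B_profile_def a_def b_def mult.assoc split: if_splits)
    }
    {
      assume "c * measure lebesgue A < measure lebesgue B"
      then have ab: "c * a < b" by (simp add: a_def b_def)
      show "ennreal (c * measure lebesgue A powr ((real DIM('a) - 2 * s) / real DIM('a))
               * (measure lebesgue B / measure lebesgue A) powr (- 2 * s / real DIM('a)))
          \<le> Lint s A (UNIV - (A \<union> B))"
      proof (cases "0 < a")
        case True
        then have "0 < b" using mult_pos_pos[OF c(1)] ab by (meson less_trans)
        \<comment> \<open>The exponents of a add up to (n - 2s)/n + 2s/n = 1, the form delivered by
          \<open>second\<close>.\<close>
        have "a powr ((real DIM('a) - 2 * s) / real DIM('a)) * (b / a) powr (- 2 * s / real DIM('a))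
            = a powr ((real DIM('a) - 2 * s) / real DIM('a) - (- 2 * s / real DIM('a)))
              * b powr (- 2 * s / real DIM('a))"
          using True \<open>0 < b\<close> by (simp only: powr_divide powr_diff) simp
        also have "(real DIM('a) - 2 * s) / real DIM('a) - (- 2 * s / real DIM('a)) = 1"
          by (simp add: field_simps)
        finally have "c * a powr ((real DIM('a) - 2 * s) / real DIM('a)) * (b / a) powr (- 2 * s / real DIM('a))
            = c * (a * b powr (- 2 * s / real DIM('a)))"
          using True by (simp add: mult.assoc)
        then show ?thesis
          using order.trans[OF second[OF vol[OF True] c(1,4) ab] Lint] by (simp only: a_def b_def)
      next
        \<comment> \<open>For |A| = 0 the convention \<open>0 powr x = 0\<close> makes the lower
          bound 0.\<close>
        case False
        then have "a = 0" using nonneg by linarith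
        then show ?thesis by (simp add: a_def)
      qed
    }
  qed
qed

end
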